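(* Let $m,s$ be positive integers such that $s\geq 2$ and $m\geq 6s$, and let $\delta\in(0,\frac1m]$. Let $\mathcal{X}=\{x_k\}_{k=1}^s\subseteq\mathbb{T}$ be a set of cardinality $s$ with $\Delta(\mathcal{X})\geq\delta$, and let $\tau\in(0,\frac12]$ be any number such that $\mathcal{X}$ satisfies the $(m,\tau)$ density criterion, i.e. $\frac{3\nu(\tau,\mathcal{X})}{\tau}\leq m$. For each $k=1,\dots,s$, define $$\mathcal{G}_k:=\mathcal{G}(x_k,\tau,\mathcal{X}),\qquad r_k:=|\mathcal{B}(x_k,\tau,\mathcal{X})|,\qquad n_k:=\left\lfloor m-\frac{2\nu(\tau,\mathcal{G}_k)}{\tau}\right\rfloor.$$ Then $$\frac{1}{\sigma_s^2(\Phi(m,\mathcal{X}))}\leq\frac{4e^2}{\pi^2}\sum_{k=1}^s 2^{\nu(\tau,\mathcal{G}_k)}\,\frac{\phi(\frac{n_k}{r_k})}{r_kn_k}\left(\frac{2e\,\phi(\frac{n_k}{r_k})}{\sin(\frac{\pi}{2}n_k\delta)}\right)^{2r_k-2},$$ and in particular, $$\sigma_s(\Phi(m,\mathcal{X}))\geq\frac{\pi}{2e}\sqrt{\frac{m}{6s}}\;\min_{1\leq k\leq s}\left\{\sqrt{\frac{r_k}{2^{\nu(\tau,\mathcal{G}_k)}}}\left(\frac{m\delta}{12e}\right)^{r_k-1}\right\}.$$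
   Context: $\mathbb{T}:=\mathbb{R}/\mathbb{Z}$ and $|t|_{\mathbb{T}}:=\min_{n\in\mathbb{Z}}|t-n|$. The minimum separation of $\mathcal{X}=\{x_k\}_{k=1}^s$ is $\Delta(\mathcal{X}):=\min_{j\neq k}|x_j-x_k|_{\mathbb{T}}$. For a set $\mathcal{X}=\{x_k\}_{k=1}^s\subseteq\mathbb{T}$ of cardinality $s$ and an integer $m\geq s$, the Fourier matrix is the $m\times s$ matrix $\Phi(m,\mathcal{X}):=[e^{-2\pi i j x_k}]_{j=0,\dots,m-1,\;k=1,\dots,s}$, and $\sigma_k(\Phi)$ denotes its $k$-th largest singular value, so $\sigma_s$ is the smallest. For $\tau\in(0,\frac12]$ and a finite set $\mathcal{U}\subseteq\mathbb{T}$, the $\tau$ local sparsity is $\nu(\tau,\mathcal{U}):=\max_{u\in\mathcal{U}}|\{u'\in\mathcal{U}\colon|u-u'|_{\mathbb{T}}\leq\tau\}|$, with $\nu(\tau,\emptyset):=0$. For $x\in\mathcal{X}$, $\mathcal{B}(x,\tau,\mathcal{X}):=\{x'\in\mathcal{X}\colon|x-x'|_{\mathbb{T}}\leq\tau\}$ and $\mathcal{G}(x,\tau,\mathcal{X}):=\{x'\in\mathcal{X}\colon|x-x'|_{\mathbb{T}}>\tau\}$. The function $\phi\colon[1,\infty)\to[1,\infty)$ is $\phi(t):=t/\lfloor t\rfloor$. *)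

theory Defs
  imports
    Complex_Main
    "HOL-Computational_Algebra.Fundamental_Theorem_Algebra"
    "Jordan_Normal_Form.Schur_Decomposition"
begin

section \<open>The torus\<close>

quotient_type torus = real / "\<lambda>a b :: real. a - b \<in> \<int>"
proof (rule equivpI)
  show "reflp (\<lambda>a b :: real. a - b \<in> \<int>)"
    by (simp add: reflp_def)
  show "symp (\<lambda>a b :: real. a - b \<in> \<int>)"
    by (rule sympI) (metis Ints_minus minus_diff_eq)
  show "transp (\<lambda>a b :: real. a - b \<in> \<int>)"
  proof (rule transpI)
    fix a b c :: real
    assume "a - b \<in> \<int>" and "b - c \<in> \<int>"
    then have "(a - b) + (b - c) \<in> \<int>" by (rule Ints_add)
    then show "a - c \<in> \<int>" by simp
  qed
qed

instantiation torus :: ab_group_add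
begin

lift_definition zero_torus :: torus is "0 :: real" .

lift_definition plus_torus :: "torus \<Rightarrow> torus \<Rightarrow> torus" is "(+) :: real \<Rightarrow> real \<Rightarrow> real"
proof -
  fix a b c d :: real
  assume "a - b \<in> \<int>" and "c - d \<in> \<int>"
  then have "(a - b) + (c - d) \<in> \<int>" by (rule Ints_add)
  then show "a + c - (b + d) \<in> \<int>" by (simp add: algebra_simps)
qed

lift_definition uminus_torus :: "torus \<Rightarrow> torus" is "uminus :: real \<Rightarrow> real"
proof -
  fix a b :: real
  assume "a - b \<in> \<int>"
  then have "- (a - b) \<in> \<int>" by (rule Ints_minus)
  then show "- a - - b \<in> \<int>" by simp
qed

lift_definition minus_torus :: "torus \<Rightarrow> torus \<Rightarrow> torus" is "(-) :: real \<Rightarrow> real \<Rightarrow> real"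
proof -
  fix a b c d :: real
  assume "a - b \<in> \<int>" and "c - d \<in> \<int>"
  then have "(a - b) - (c - d) \<in> \<int>" by (rule Ints_diff)
  then show "a - c - (b - d) \<in> \<int>" by (simp add: algebra_simps)
qed

instance
  by standard (transfer; simp)+

end

lift_definition torus_norm :: "torus \<Rightarrow> real" is
  "\<lambda>t. INF n::int. \<bar>t - of_int n\<bar>"
proof -
  fix a b :: real
  assume "a - b \<in> \<int>"
  then obtain k :: int where k: "a = b + of_int k"
    by (metis Ints_cases add.commute diff_add_cancel)
  have "range (\<lambda>n::int. \<bar>a - of_int n\<bar>) = range (\<lambda>n::int. \<bar>b - of_int n\<bar>)"
  proof (intro equalityI subsetI)
    fix y assume "y \<in> range (\<lambda>n::int. \<bar>a - of_int n\<bar>)"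
    then obtain n :: int where "y = \<bar>a - of_int n\<bar>" by blast
    then have "y = \<bar>b - of_int (n - k)\<bar>" by (simp add: k algebra_simps)
    then show "y \<in> range (\<lambda>n::int. \<bar>b - of_int n\<bar>)" by blast
  next
    fix y assume "y \<in> range (\<lambda>n::int. \<bar>b - of_int n\<bar>)"
    then obtain n :: int where "y = \<bar>b - of_int n\<bar>" by blast
    then have "y = \<bar>a - of_int (n + k)\<bar>" by (simp add: k algebra_simps)
    then show "y \<in> range (\<lambda>n::int. \<bar>a - of_int n\<bar>)" by blast
  qed
  then show "(INF n::int. \<bar>a - of_int n\<bar>) = (INF n::int. \<bar>b - of_int n\<bar>)" by simp
qed

text \<open>The infimum is attained, so it is a minimum over the integers.\<close>

lemma torus_norm_abs_torus: "torus_norm (abs_torus t) = \<bar>t - of_int (round t)\<bar>"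
proof -
  have "(INF n::int. \<bar>t - of_int n\<bar>) = \<bar>t - of_int (round t)\<bar>"
  proof (rule cInf_eq_minimum)
    show "\<bar>t - of_int (round t)\<bar> \<in> range (\<lambda>n::int. \<bar>t - of_int n\<bar>)" by blast
    fix y assume "y \<in> range (\<lambda>n::int. \<bar>t - of_int n\<bar>)"
    then obtain n :: int where "y = \<bar>t - of_int n\<bar>" by blast
    then show "\<bar>t - of_int (round t)\<bar> \<le> y" using round_diff_minimal[of t n] by simp
  qed
  then show ?thesis by (simp add: torus_norm.abs_eq)
qed

lift_definition torus_char :: "nat \<Rightarrow> torus \<Rightarrow> complex" is
  "\<lambda>j t. exp (- 2 * complex_of_real pi * \<i> * of_nat j * complex_of_real t)"
proof -
  fix j :: nat and a b :: real
  assume "a - b \<in> \<int>"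
  then obtain k :: int where k: "a = b + of_int k"
    by (metis Ints_cases add.commute diff_add_cancel)
  have "exp (- 2 * complex_of_real pi * \<i> * of_nat j * complex_of_real a) =
        exp (- 2 * complex_of_real pi * \<i> * of_nat j * complex_of_real b
             + \<i> * complex_of_real (2 * pi * of_int (- (int j * k))))"
    by (simp add: k algebra_simps)
  also have "\<dots> = exp (- 2 * complex_of_real pi * \<i> * of_nat j * complex_of_real b)"
    by (simp only: exp_add cis_conv_exp[symmetric] cis_multiple_2pi[OF Ints_of_int] mult_1_right)
  finally show "exp (- 2 * complex_of_real pi * \<i> * of_nat j * complex_of_real a) =
    exp (- 2 * complex_of_real pi * \<i> * of_nat j * complex_of_real b)" .
qed

section \<open>Geometry of finite subsets of the torus\<close>

text \<open>Only meaningful for finite sets with at least two elements.\<close>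

definition min_separation :: "torus set \<Rightarrow> real" where
  "min_separation X = Min {torus_norm (y - y') | y y'. y \<in> X \<and> y' \<in> X \<and> y \<noteq> y'}"

definition near_points :: "torus \<Rightarrow> real \<Rightarrow> torus set \<Rightarrow> torus set" where
  "near_points y \<tau> X = {y' \<in> X. torus_norm (y - y') \<le> \<tau>}"

definition far_points :: "torus \<Rightarrow> real \<Rightarrow> torus set \<Rightarrow> torus set" where
  "far_points y \<tau> X = {y' \<in> X. torus_norm (y - y') > \<tau>}"

definition local_sparsity :: "real \<Rightarrow> torus set \<Rightarrow> nat" where
  "local_sparsity \<tau> U =
     (if U = {} then 0 else Max ((\<lambda>u. card (near_points u \<tau> U)) ` U))"

definition density_criterion :: "nat \<Rightarrow> real \<Rightarrow> torus set \<Rightarrow> bool" where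
  "density_criterion m \<tau> X \<longleftrightarrow> 3 * real (local_sparsity \<tau> X) / \<tau> \<le> real m"

text \<open>Used only for arguments at least 1, where the denominator is nonzero.\<close>

definition floor_ratio :: "real \<Rightarrow> real" where
  "floor_ratio t = t / of_int \<lfloor>t\<rfloor>"

section \<open>Singular values and the Fourier matrix\<close>

text \<open>
  The singular values of a matrix \<open>A\<close>, listed with multiplicity in decreasing order, are the
  square roots of the eigenvalues of \<open>A\<^sup>* A\<close>. These are real and nonnegative, so
  taking real parts only changes the type. The list has one entry per column, hence for a matrix
  with more columns than rows it also contains the surplus zeros.
\<close>

definition singular_values :: "complex mat \<Rightarrow> real list" where
  "singular_values A =
     rev (sorted_list_of_multiset
       (image_mset (\<lambda>z. sqrt (Re z)) (proots (char_poly (mat_adjoint A * A)))))"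

text \<open>The \<open>k\<close>-th largest singular value, counting from \<open>k = 1\<close>.\<close>

definition singular_value :: "nat \<Rightarrow> complex mat \<Rightarrow> real" where
  "singular_value k A = singular_values A ! (k - 1)"

lemma length_singular_values:
  assumes "A \<in> carrier_mat m s"
  shows "length (singular_values A) = s"
proof -
  have "mat_adjoint A * A \<in> carrier_mat s s"
    using assms by (auto simp: mat_adjoint_def)
  then have "degree (char_poly (mat_adjoint A * A)) = s"
    using degree_monic_char_poly by blast
  then have "size (mset (singular_values A)) = s"
    unfolding singular_values_def by (simp add: size_proots_complex del: size_mset)
  then show ?thesis by simp
qed

text \<open>
  The nodes are indexed from 1 and the rows of the Fourier matrix from 0, while matrix indices
  always start at 0: column \<open>k\<close> belongs to the node \<open>x (Suc k)\<close>.
\<close>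

definition fourier_matrix :: "nat \<Rightarrow> nat \<Rightarrow> (nat \<Rightarrow> torus) \<Rightarrow> complex mat" where
  "fourier_matrix m s x = mat m s (\<lambda>(j, k). torus_char j (x (Suc k)))"

end

theory Submission
  imports Defs "HOL-Analysis.Complex_Transcendental"
begin

text \<open>
  Write \<open>z\<^sub>k\<close> for the point of the unit circle belonging to the node \<open>x\<^sub>k\<close>. Polynomials \<open>f\<^sub>k\<close> of degree
  less than \<open>m\<close> with \<open>f\<^sub>k(z\<^sub>l) = \<delta>\<^sub>k\<^sub>l\<close> are the rows of a left inverse of the Fourier matrix, so the sum
  of their squared coefficient norms bounds \<open>1 / \<sigma>\<^sub>s\<^sup>2\<close>. Take \<open>f\<^sub>k = b\<^sub>k g\<^sub>k\<close>, where \<open>b\<^sub>k\<close> vanishes at the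
  other nodes near \<open>x\<^sub>k\<close> and \<open>g\<^sub>k\<close> at the far ones. A greedy colouring splits the far nodes into \<open>\<nu>\<close>
  classes, each of them \<open>\<tau>\<close>-separated. For one class, Fejer kernels of degree less than \<open>1 / \<tau>\<close> have a
  diagonally dominant Gram matrix, which yields an interpolating polynomial of degree at most
  \<open>2 / \<tau>\<close> and squared modulus at most 2 on the circle. Finally \<open>b\<^sub>k\<close> is a normalised Dirichlet kernel
  of length \<open>q = \<lfloor>n\<^sub>k / r\<^sub>k\<rfloor>\<close> times factors \<open>(z\<^sup>p - u\<^sup>p) / (z\<^sub>k\<^sup>p - u\<^sup>p)\<close>, one for each near node \<open>u\<close>, with
  \<open>p \<le> q\<close> chosen so that the denominator is not small; the \<open>j\<close>-th nearest node has distance at least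
  \<open>j \<delta> / 2\<close>.
\<close>

section \<open>Trigonometric inequalities\<close>

lemma x_cos_le_sin:
  fixes x :: real
  assumes "0 \<le> x" "x \<le> pi"
  shows "x * cos x \<le> sin x"
proof -
  have "sin 0 - 0 * cos 0 \<le> sin x - x * cos x"
  proof (rule DERIV_nonneg_imp_nondecreasing[OF assms(1)])
    fix t assume "0 \<le> t" "t \<le> x"
    then have "0 \<le> t * sin t" using assms by (intro mult_nonneg_nonneg sin_ge_zero) auto
    moreover have "((\<lambda>x. sin x - x * cos x) has_real_derivative t * sin t) (at t)"
      by (auto intro!: derivative_eq_intros)
    ultimately show "\<exists>y. ((\<lambda>x. sin x - x * cos x) has_real_derivative y) (at t) \<and> 0 \<le> y"
      by blast
  qed
  then show ?thesis by simp
qed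

text \<open>Jordan's inequality: sin y / y decreases on (0, pi / 2], so it is smallest at the right
  end.\<close>

lemma two_x_le_sin_pi:
  fixes x :: real
  assumes "0 \<le> x" "x \<le> 1 / 2"
  shows "2 * x \<le> sin (pi * x)"
proof (cases "x = 0")
  case False
  define y where "y = pi * x"
  have y: "0 < y" "y \<le> pi / 2" using assms False by (auto simp: y_def)
  have "sin (pi / 2) / (pi / 2) \<le> sin y / y"
  proof (rule DERIV_nonpos_imp_nonincreasing[OF y(2)])
    fix t assume t: "y \<le> t" "t \<le> pi / 2"
    then have "t \<noteq> 0" using y by simp
    then have "((\<lambda>x. sin x / x) has_real_derivative (t * cos t - sin t) / t\<^sup>2) (at t)"
      by (auto intro!: derivative_eq_intros simp: power2_eq_square field_simps)
    moreover have "(t * cos t - sin t) / t\<^sup>2 \<le> 0"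
      using x_cos_le_sin[of t] t y pi_half_gt_zero by (intro divide_nonpos_nonneg) auto
    ultimately show "\<exists>d. ((\<lambda>x. sin x / x) has_real_derivative d) (at t) \<and> d \<le> 0" by blast
  qed
  then show ?thesis using y assms False by (simp add: y_def field_simps)
qed simp

lemma sin_pi_ge_two_div_pi:
  fixes x :: real
  assumes "1 / 4 \<le> x" "x \<le> 1 / 2"
  shows "2 / pi \<le> sin (pi * x)"
proof -
  have "sin (pi / 4) \<le> sin (pi * x)"
    using assms by (intro sin_monotone_2pi_le) auto
  moreover have "2 / pi \<le> sqrt 2 / 2"
  proof (rule power2_le_imp_le)
    have "3 * 3 \<le> pi * pi" using pi_gt3 by (intro mult_mono) auto
    then show "(2 / pi)\<^sup>2 \<le> (sqrt 2 / 2)\<^sup>2"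
      by (simp add: power2_eq_square field_simps)
  qed simp
  ultimately show ?thesis by (simp add: sin_45)
qed

text \<open>This selects the power that moves two nodes at distance \<open>d\<close> well apart. If
  \<open>q * d\<close> is at most 1/2, the power \<open>q\<close> itself serves by Jordan's
  inequality; otherwise a smaller power brings \<open>p * d\<close> into [1/4, 1/2], where the sine
  is at least 2 / pi.\<close>

lemma exists_frequency:
  fixes d :: real and q :: nat
  assumes d: "0 < d" "d \<le> 1 / 2" and q: "1 \<le> q"
  obtains p :: nat where "1 \<le> p" "p \<le> q" "min (2 * real q * d) (2 / pi) \<le> sin (pi * (real p * d))"
proof (cases "2 * real q * d \<le> 1")
  case True
  show ?thesis
  proof (rule that[of q])
    have "2 * (real q * d) \<le> sin (pi * (real q * d))"
      using True d by (intro two_x_le_sin_pi) auto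
    then show "min (2 * real q * d) (2 / pi) \<le> sin (pi * (real q * d))" by simp
  qed (use q in auto)
next
  case False
  define p where "p = nat \<lfloor>1 / (2 * d)\<rfloor>"
  have one: "1 \<le> 1 / (2 * d)" using d by (simp add: field_simps)
  have p1: "1 \<le> p" using one unfolding p_def by linarith
  have ple: "real p \<le> 1 / (2 * d)" and pgt: "1 / (2 * d) < real p + 1"
    using one unfolding p_def by linarith+
  have "1 / (2 * d) < real q" using False d by (simp add: field_simps)
  then have pq: "p \<le> q" using ple by linarith
  have "real p * d \<le> 1 / 2" using ple d by (simp add: field_simps)
  \<comment> \<open>Rounding down at most halves a number that is at least 1:
    \<open>1 / (2 * d) < p + 1 \<le> 2 * p\<close>.\<close>
  moreover have "1 / (2 * d) \<le> 2 * real p" using pgt p1 by linarith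
  then have "1 / 4 \<le> real p * d" using d by (simp add: field_simps)
  ultimately have "2 / pi \<le> sin (pi * (real p * d))" by (intro sin_pi_ge_two_div_pi)
  then show ?thesis using p1 pq by (intro that[of p]) auto
qed

section \<open>Sums of inverse squared sines over separated points\<close>

text \<open>The right-hand side is the mean of \<open>1 / sin\<^sup>2\<close> over \<open>[a - h, a + h]\<close>, so this is
  a consequence of convexity.\<close>

lemma inverse_sin_squared_le_cot_diff:
  fixes a h :: real
  assumes h: "0 < h" "h < pi / 2" and a: "h < a" "a < pi - h"
  shows "1 / (sin a)\<^sup>2 \<le> (cot (a - h) - cot (a + h)) / (2 * h)"
proof -
  have s1: "sin (a - h) > 0" and s2: "sin (a + h) > 0" and s0: "sin a > 0"
    using assms by (auto intro!: sin_gt_zero)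
  have prod: "sin (a - h) * sin (a + h) = (sin a)\<^sup>2 - (sin h)\<^sup>2"
  proof -
    have "sin (a - h) * sin (a + h) = (sin a)\<^sup>2 * (cos h)\<^sup>2 - (cos a)\<^sup>2 * (sin h)\<^sup>2"
      by (simp add: sin_add sin_diff algebra_simps power2_eq_square)
    then show ?thesis by (simp add: cos_squared_eq algebra_simps)
  qed
  have num: "cos (a - h) * sin (a + h) - cos (a + h) * sin (a - h) = sin (2 * h)"
    using sin_diff[of "a + h" "a - h"] by (simp add: algebra_simps)
  have c: "(cot (a - h) - cot (a + h)) = sin (2 * h) / (sin (a - h) * sin (a + h))"
    using s1 s2 num by (simp add: cot_def field_simps)
  \<comment> \<open>With denominators cleared, the claim is the sum of two estimates:
    \<open>h * cos h \<le> sin h\<close> multiplied by \<open>2 * cos h\<close>, and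
    \<open>sin (2 * h) \<le> 2 * h\<close> multiplied by the square of \<open>cos a\<close>.\<close>
  have "h * cos h \<le> sin h" using h by (intro x_cos_le_sin) auto
  then have "h * cos h * (2 * cos h) \<le> sin h * (2 * cos h)"
    using h by (intro mult_right_mono) (auto intro!: cos_ge_zero)
  then have "2 * h * (cos h)\<^sup>2 \<le> sin (2 * h)"
    unfolding sin_double power2_eq_square by (simp add: mult_ac)
  then have "2 * h * (1 - (sin h)\<^sup>2) \<le> sin (2 * h)"
    by (simp add: cos_squared_eq)
  moreover have "sin (2 * h) \<le> 2 * h" using h by (intro sin_x_le_x) auto
  then have "(1 - (sin a)\<^sup>2) * sin (2 * h) \<le> (1 - (sin a)\<^sup>2) * (2 * h)"
    by (intro mult_left_mono) (auto simp: abs_square_le_1)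
  ultimately have "2 * h * ((sin a)\<^sup>2 - (sin h)\<^sup>2) \<le> sin (2 * h) * (sin a)\<^sup>2"
    by (simp add: algebra_simps)
  then have "2 * h * (sin (a - h) * sin (a + h)) \<le> sin (2 * h) * (sin a)\<^sup>2"
    by (simp only: prod)
  moreover have "sin (a - h) * sin (a + h) > 0" using s1 s2 by simp
  ultimately show ?thesis using s0 h by (simp add: c field_simps)
qed

lemma cot_antimono:
  fixes a b :: real
  assumes "0 < a" "a \<le> b" "b < pi"
  shows "cot b \<le> cot a"
proof -
  have s: "sin a > 0" "sin b > 0" using assms by (auto intro!: sin_gt_zero)
  have "sin (b - a) \<ge> 0" using assms by (intro sin_ge_zero) auto
  then have "cos b * sin a \<le> cos a * sin b" by (simp add: sin_diff algebra_simps)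
  then show ?thesis using s by (simp add: cot_def field_simps)
qed

text \<open>The right-hand side is the integral of the inverse squared sine of pi t over
  [\<tau>/2, b + \<tau>/2], divided by \<tau>. Each summand is at most its mean over an interval of
  length \<tau> around its point, and these intervals do not overlap. The free endpoint
  \<open>b\<close> carries the induction: once the largest point \<open>c\<close> is removed, all
  others lie below \<open>c - \<tau>\<close>.\<close>

lemma sum_inverse_sin_squared_le_cot:
  fixes T :: "real set" and \<tau> :: real
  assumes "finite T" and \<tau>: "0 < \<tau>" "\<tau> < 1"
    and sep: "\<And>s t. s \<in> T \<Longrightarrow> t \<in> T \<Longrightarrow> s \<noteq> t \<Longrightarrow> \<tau> \<le> \<bar>s - t\<bar>"
    and "\<And>t. t \<in> T \<Longrightarrow> \<tau> \<le> t \<and> t \<le> b" and "0 \<le> b" "b \<le> 1 - \<tau>"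
  shows "(\<Sum>t\<in>T. 1 / (sin (pi * t))\<^sup>2)
    \<le> (cot (pi * \<tau> / 2) - cot (pi * (b + \<tau> / 2))) / (pi * \<tau>)"
  using assms(1) sep assms(5-)
proof (induction T arbitrary: b rule: finite_linorder_max_induct)
  case empty
  have "cot (pi * (b + \<tau> / 2)) \<le> cot (pi * \<tau> / 2)"
    using empty \<tau> by (intro cot_antimono) auto
  then show ?case using \<tau> by simp
next
  case (insert c T)
  have c: "\<tau> \<le> c" "c \<le> b" using insert.prems by auto
  have Tb: "\<tau> \<le> t \<and> t \<le> c - \<tau>" if "t \<in> T" for t
    using insert.prems(1)[of t c] insert.prems(2)[of t] insert.hyps(2) that by force
  have IH: "(\<Sum>t\<in>T. 1 / (sin (pi * t))\<^sup>2)
      \<le> (cot (pi * \<tau> / 2) - cot (pi * ((c - \<tau>) + \<tau> / 2))) / (pi * \<tau>)"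
    by (rule insert.IH) (use insert.prems Tb c \<tau> in force)+
  have m: "pi * \<tau> / 2 < pi * c" "pi * c < pi - pi * \<tau> / 2"
  proof -
    show "pi * \<tau> / 2 < pi * c" using c \<tau> by simp
    have "c < 1 - \<tau> / 2" using c(2) \<tau> insert.prems(4) by linarith
    then have "pi * c < pi * (1 - \<tau> / 2)" by (intro mult_strict_left_mono) auto
    then show "pi * c < pi - pi * \<tau> / 2" by (simp add: algebra_simps)
  qed
  have "1 / (sin (pi * c))\<^sup>2
      \<le> (cot (pi * c - pi * \<tau> / 2) - cot (pi * c + pi * \<tau> / 2)) / (2 * (pi * \<tau> / 2))"
    using \<tau> m by (intro inverse_sin_squared_le_cot_diff) auto
  moreover have "pi * c - pi * \<tau> / 2 = pi * ((c - \<tau>) + \<tau> / 2)" by (simp add: algebra_simps)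
  moreover have "cot (pi * (b + \<tau> / 2)) \<le> cot (pi * c + pi * \<tau> / 2)"
  proof (rule cot_antimono)
    have "pi * (b + \<tau> / 2) < pi * 1" using \<tau> insert.prems by (intro mult_strict_left_mono) auto
    then show "pi * (b + \<tau> / 2) < pi" by simp
    have "pi * (c + \<tau> / 2) \<le> pi * (b + \<tau> / 2)" using c by (intro mult_left_mono) auto
    then show "pi * c + pi * \<tau> / 2 \<le> pi * (b + \<tau> / 2)" by (simp add: algebra_simps)
  qed (use c \<tau> in \<open>auto intro!: add_pos_pos\<close>)
  then have "(cot (pi * ((c - \<tau>) + \<tau> / 2)) - cot (pi * c + pi * \<tau> / 2)) / (pi * \<tau>)
      \<le> (cot (pi * ((c - \<tau>) + \<tau> / 2)) - cot (pi * (b + \<tau> / 2))) / (pi * \<tau>)"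
    using \<tau> by (intro divide_right_mono) auto
  ultimately have "1 / (sin (pi * c))\<^sup>2
      \<le> (cot (pi * ((c - \<tau>) + \<tau> / 2)) - cot (pi * (b + \<tau> / 2))) / (pi * \<tau>)"
    by simp
  moreover have "c \<notin> T" using insert.hyps by auto
  ultimately show ?case using IH insert.hyps(1) by (simp add: diff_divide_distrib)
qed

text \<open>For \<open>b = 1 - \<tau>\<close> the two cotangents are opposite, and the bound becomes
  \<open>cot h / h\<close>, at most the inverse square of \<open>h = pi * \<tau> / 2\<close>. The
  constant 1/2 follows from pi squared being at least 8; it is what makes the Gram matrix of the
  Fejer kernels diagonally dominant.\<close>

lemma sum_inverse_sin_squared_le:
  fixes T :: "real set" and \<tau> :: real
  assumes "finite T" and \<tau>: "0 < \<tau>" "\<tau> < 1"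
    and sep: "\<And>s t. s \<in> T \<Longrightarrow> t \<in> T \<Longrightarrow> s \<noteq> t \<Longrightarrow> \<tau> \<le> \<bar>s - t\<bar>"
    and T: "\<And>t. t \<in> T \<Longrightarrow> \<tau> \<le> t \<and> t \<le> 1 - \<tau>"
  shows "(\<Sum>t\<in>T. 1 / (sin (pi * t))\<^sup>2) \<le> 1 / (2 * \<tau>\<^sup>2)"
proof -
  define h where "h = pi * \<tau> / 2"
  have h: "0 < h" "h < pi / 2" using \<tau> by (auto simp: h_def)
  have s: "sin h > 0" using h by (intro sin_gt_zero) auto
  have "pi * (1 - \<tau> + \<tau> / 2) = pi - h" by (simp add: h_def algebra_simps)
  then have "cot (pi * (1 - \<tau> + \<tau> / 2)) = - cot h" by (simp add: cot_def)
  then have "(\<Sum>t\<in>T. 1 / (sin (pi * t))\<^sup>2) \<le> (cot h + cot h) / (pi * \<tau>)"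
    using sum_inverse_sin_squared_le_cot[OF assms(1) \<tau> sep, of "1 - \<tau>"] T \<tau> by (simp add: h_def)
  also have "\<dots> = cot h / h" by (simp add: h_def)
  also have "\<dots> \<le> 1 / h / h"
    using h s x_cos_le_sin[of h] by (intro divide_right_mono) (auto simp: cot_def field_simps)
  also have "\<dots> = 4 / (pi * pi * \<tau>\<^sup>2)" by (simp add: h_def power2_eq_square)
  also have "\<dots> \<le> 1 / (2 * \<tau>\<^sup>2)"
  proof -
    have "8 \<le> pi * pi" using pi_gt3 mult_mono[of 3 pi 3 pi] by simp
    then show ?thesis using \<tau> by (simp add: field_simps)
  qed
  finally show ?thesis .
qed

section \<open>Points of the torus as points of the circle\<close>

lemma torus_char_abs_torus: "torus_char j (abs_torus t) = cis (- 2 * pi * real j * t)"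
  by (simp add: torus_char.abs_eq cis_conv_exp mult_ac)

lemma torus_char_conv_power: "torus_char j y = torus_char 1 y ^ j"
proof -
  obtain t where "y = abs_torus t" by (metis Quotient3_abs_rep Quotient3_torus)
  moreover have "cis (- 2 * pi * real 1 * t) ^ j = cis (real j * (- 2 * pi * real 1 * t))"
    by (rule Complex.DeMoivre)
  ultimately show ?thesis by (simp add: torus_char_abs_torus mult_ac)
qed

lemma norm_torus_char [simp]: "cmod (torus_char j y) = 1"
proof -
  obtain t where "y = abs_torus t" by (metis Quotient3_abs_rep Quotient3_torus)
  then show ?thesis by (simp add: torus_char_abs_torus)
qed

lemma torus_norm_abs_le: "torus_norm (abs_torus t) \<le> \<bar>t\<bar>"
  using round_diff_minimal[of t 0] by (simp add: torus_norm_abs_torus)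

lemma torus_lift_abs:
  obtains t where "y = abs_torus t" "\<bar>t\<bar> = torus_norm y" "\<bar>t\<bar> \<le> 1 / 2"
proof -
  obtain u where u: "y = abs_torus u" by (metis Quotient3_abs_rep Quotient3_torus)
  have "abs_torus (u - of_int (round u)) = y"
    by (simp add: u torus.abs_eq_iff)
  then show ?thesis
    using that[of "u - of_int (round u)"] u of_int_round_abs_le[of u]
    by (simp add: torus_norm_abs_torus abs_minus_commute)
qed

lemma torus_norm_nonneg: "0 \<le> torus_norm y" and torus_norm_le_half: "torus_norm y \<le> 1 / 2"
  using torus_lift_abs[of y] by (metis abs_ge_zero)+

lemma torus_norm_0: "torus_norm 0 = 0"
  using torus_norm_abs_le[of 0] torus_norm_nonneg[of 0] by (simp add: zero_torus.abs_eq)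

lemma torus_norm_minus_commute: "torus_norm (y - y') = torus_norm (y' - y)"
proof -
  have le: "torus_norm (- y) \<le> torus_norm y" for y
  proof -
    obtain t where "y = abs_torus t" "\<bar>t\<bar> = torus_norm y" by (rule torus_lift_abs)
    then show ?thesis using torus_norm_abs_le[of "- t"] by (simp add: uminus_torus.abs_eq)
  qed
  show ?thesis using le[of "y - y'"] le[of "y' - y"] by simp
qed

text \<open>The nearest representative has a sign; shifting the negative ones by 1 puts both sides
  of a node into one interval and preserves the squared sine, so that sums over the torus become
  sums over the line.\<close>

lemma torus_lift_unit_interval:
  obtains t where "y = abs_torus t" "torus_norm y \<le> t" "t \<le> 1 - torus_norm y"
    "(sin (pi * t))\<^sup>2 = (sin (pi * torus_norm y))\<^sup>2"
proof -
  obtain u where u: "y = abs_torus u" "\<bar>u\<bar> = torus_norm y" "\<bar>u\<bar> \<le> 1 / 2" by (rule torus_lift_abs)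
  show ?thesis
  proof (cases "0 \<le> u")
    case True
    then show ?thesis using u by (intro that[of u]) auto
  next
    case False
    have "y = abs_torus (u + 1)" by (simp add: u(1) torus.abs_eq_iff)
    moreover have "sin (pi * (u + 1)) = sin (pi * torus_norm y)"
    proof -
      have "torus_norm y = - u" using False u(2) by simp
      then show ?thesis by (simp add: distrib_left)
    qed
    ultimately show ?thesis using False u by (intro that[of "u + 1"]) auto
  qed
qed

lemma torus_char_eq_cis:
  assumes "y - y' = abs_torus t"
  shows "torus_char j y = torus_char j y' * cis (- 2 * pi * real j * t)"
proof -
  obtain u where u: "y' = abs_torus u" by (metis Quotient3_abs_rep Quotient3_torus)
  have "y = y' + (y - y')" by simp
  then have "y = abs_torus (u + t)" by (metis assms u plus_torus.abs_eq)
  then show ?thesis by (simp add: u torus_char_abs_torus cis_mult algebra_simps)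
qed

lemma cmod_one_minus_cis: "cmod (1 - cis x) = 2 * \<bar>sin (x / 2)\<bar>"
proof -
  have "(cmod (1 - cis x))\<^sup>2 = (1 - cos x)\<^sup>2 + (sin x)\<^sup>2"
    by (simp add: cmod_power2)
  also have "\<dots> = 2 - 2 * cos (2 * (x / 2))"
    using sin_cos_squared_add[of x] by (simp add: power2_diff)
  also have "\<dots> = (2 * \<bar>sin (x / 2)\<bar>)\<^sup>2"
    by (subst cos_double_sin) (simp add: power_mult_distrib)
  finally show ?thesis by (rule power2_eq_imp_eq) auto
qed

text \<open>A chord spanning the angle 2 pi j t has length twice the sine of half that angle, up to
  sign, and the absolute value makes the sign of the lift irrelevant.\<close>

lemma cmod_torus_char_diff:
  "cmod (torus_char j y - torus_char j y') = 2 * \<bar>sin (pi * (real j * torus_norm (y - y')))\<bar>"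
proof -
  obtain t where t: "y - y' = abs_torus t" "\<bar>t\<bar> = torus_norm (y - y')" by (rule torus_lift_abs)
  have "torus_char j y' - torus_char j y = torus_char j y' * (1 - cis (- 2 * pi * real j * t))"
    by (simp add: torus_char_eq_cis[OF t(1)] algebra_simps)
  then have "cmod (torus_char j y - torus_char j y') = 2 * \<bar>sin (pi * (real j * t))\<bar>"
    by (simp add: norm_minus_commute[of "torus_char j y"] norm_mult cmod_one_minus_cis mult_ac)
  also have "\<bar>sin (pi * (real j * t))\<bar> = \<bar>sin (pi * (real j * \<bar>t\<bar>))\<bar>"
    by (cases "0 \<le> t") auto
  finally show ?thesis by (simp add: t(2))
qed

text \<open>Lift the differences \<open>u - y\<close> to the unit interval. Projection to the torus
  does not increase distances, so the lifts stay \<tau>-separated, and they lie in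
  [\<tau>, 1 - \<tau>]; the estimate on the line applies.\<close>

lemma torus_sum_inverse_sin_squared_le:
  assumes Y: "finite Y" and \<tau>: "0 < \<tau>" "\<tau> < 1" and "y \<in> Y"
    and sep: "\<And>u v. u \<in> Y \<Longrightarrow> v \<in> Y \<Longrightarrow> u \<noteq> v \<Longrightarrow> \<tau> \<le> torus_norm (u - v)"
  shows "(\<Sum>u\<in>Y - {y}. 1 / (sin (pi * torus_norm (u - y)))\<^sup>2) \<le> 1 / (2 * \<tau>\<^sup>2)"
proof -
  have "\<exists>t. u - y = abs_torus t \<and> torus_norm (u - y) \<le> t \<and> t \<le> 1 - torus_norm (u - y)
    \<and> (sin (pi * t))\<^sup>2 = (sin (pi * torus_norm (u - y)))\<^sup>2" for u
    using torus_lift_unit_interval[of "u - y"] by metis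
  then obtain l where l: "u - y = abs_torus (l u)" "torus_norm (u - y) \<le> l u"
    "l u \<le> 1 - torus_norm (u - y)" "(sin (pi * l u))\<^sup>2 = (sin (pi * torus_norm (u - y)))\<^sup>2" for u
    by metis
  have diff: "torus_norm (u - v) \<le> \<bar>l u - l v\<bar>" for u v
  proof -
    have "u - v = (u - y) - (v - y)" by simp
    then have "u - v = abs_torus (l u - l v)" by (metis l(1) minus_torus.abs_eq)
    then show ?thesis using torus_norm_abs_le by metis
  qed
  have inj: "inj_on l (Y - {y})"
  proof (rule inj_onI, rule ccontr)
    fix u v assume "u \<in> Y - {y}" "v \<in> Y - {y}" "l u = l v" "u \<noteq> v"
    then show False using diff[of u v] sep[of u v] \<tau> by auto
  qed
  have "(\<Sum>u\<in>Y - {y}. 1 / (sin (pi * torus_norm (u - y)))\<^sup>2)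
      = (\<Sum>t\<in>l ` (Y - {y}). 1 / (sin (pi * t))\<^sup>2)"
    by (simp add: sum.reindex[OF inj] l(4))
  also have "\<dots> \<le> 1 / (2 * \<tau>\<^sup>2)"
  proof (rule sum_inverse_sin_squared_le)
    show "\<tau> \<le> \<bar>s - t\<bar>" if "s \<in> l ` (Y - {y})" "t \<in> l ` (Y - {y})" "s \<noteq> t" for s t
    proof -
      obtain u v where uv: "u \<in> Y" "v \<in> Y" "s = l u" "t = l v" using \<open>s \<in> _\<close> \<open>t \<in> _\<close> by auto
      then have "u \<noteq> v" using \<open>s \<noteq> t\<close> by auto
      then show ?thesis using sep[of u v] diff[of u v] uv by simp
    qed
    show "\<tau> \<le> t \<and> t \<le> 1 - \<tau>" if t: "t \<in> l ` (Y - {y})" for t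
    proof -
      obtain u where "u \<in> Y" "u \<noteq> y" "t = l u" using t by auto
      then show ?thesis using l(2,3)[of u] sep[of u y] \<open>y \<in> Y\<close> by auto
    qed
  qed (use Y \<tau> in auto)
  finally show ?thesis .
qed

lemma card_separated_le:
  fixes T :: "real set" and \<delta> :: real
  assumes "finite T" "T \<noteq> {}"
    and "\<And>s t. s \<in> T \<Longrightarrow> t \<in> T \<Longrightarrow> s \<noteq> t \<Longrightarrow> \<delta> \<le> \<bar>s - t\<bar>"
  shows "(real (card T) - 1) * \<delta> \<le> Max T - Min T"
  using assms
proof (induction T rule: finite_linorder_max_induct)
  case (insert c T)
  show ?case
  proof (cases "T = {}")
    case False
    then have M: "Max T \<in> T" and IH: "(real (card T) - 1) * \<delta> \<le> Max T - Min T"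
      using insert by auto
    have "\<delta> \<le> \<bar>c - Max T\<bar>" using M insert.hyps(2) by (intro insert.prems) auto
    then have "\<delta> \<le> c - Max T" using M insert.hyps(2) by force
    moreover have "Max (insert c T) = c" "Min (insert c T) = Min T"
    proof -
      have "Max T < c" "Min T < c" using insert.hyps(1,2) False M Min_in by auto
      then show "Max (insert c T) = c" "Min (insert c T) = Min T"
        using insert.hyps(1) False by auto
    qed
    moreover have "c \<notin> T" using insert.hyps by auto
    ultimately show ?thesis using IH insert.hyps(1) False by (simp add: algebra_simps)
  qed simp
qed simp

text \<open>The points of \<open>A\<close> and \<open>y\<close> itself lift to an interval of length \<open>2 d\<close>.\<close>

lemma farthest_point_distance:
  assumes A: "finite A" "y \<notin> A"
    and sep: "\<And>u v. u \<in> insert y A \<Longrightarrow> v \<in> insert y A \<Longrightarrow> u \<noteq> v \<Longrightarrow> \<delta> \<le> torus_norm (u - v)"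
    and \<delta>: "0 < \<delta>" and d: "\<And>u. u \<in> A \<Longrightarrow> torus_norm (u - y) \<le> d" "0 \<le> d"
  shows "real (card A) * \<delta> \<le> 2 * d"
proof -
  have "\<exists>t. u - y = abs_torus t \<and> \<bar>t\<bar> = torus_norm (u - y)" for u
    using torus_lift_abs[of "u - y"] by metis
  then obtain l where l: "u - y = abs_torus (l u)" "\<bar>l u\<bar> = torus_norm (u - y)" for u
    by metis
  have diff: "torus_norm (u - v) \<le> \<bar>l u - l v\<bar>" for u v
  proof -
    have "u - v = (u - y) - (v - y)" by simp
    then have "u - v = abs_torus (l u - l v)" by (metis l(1) minus_torus.abs_eq)
    then show ?thesis using torus_norm_abs_le by metis
  qed
  let ?T = "l ` insert y A"
  have inj: "inj_on l (insert y A)"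
  proof (rule inj_onI, rule ccontr)
    fix u v assume "u \<in> insert y A" "v \<in> insert y A" "l u = l v" "u \<noteq> v"
    then show False using diff[of u v] sep[of u v] \<delta> by auto
  qed
  have bd: "\<bar>t\<bar> \<le> d" if "t \<in> ?T" for t using that d l(2) torus_norm_0 by auto
  have "(real (card ?T) - 1) * \<delta> \<le> Max ?T - Min ?T"
  proof (rule card_separated_le)
    show "\<delta> \<le> \<bar>s - t\<bar>" if "s \<in> ?T" "t \<in> ?T" "s \<noteq> t" for s t
    proof -
      obtain u v where uv: "u \<in> insert y A" "v \<in> insert y A" "s = l u" "t = l v"
        using \<open>s \<in> _\<close> \<open>t \<in> _\<close> by blast
      then have "u \<noteq> v" using \<open>s \<noteq> t\<close> by auto
      then show ?thesis using sep[of u v] diff[of u v] uv by simp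
    qed
  qed (use A in auto)
  moreover have T: "finite ?T" "?T \<noteq> {}" using A by auto
  have "Max ?T \<in> ?T" "Min ?T \<in> ?T" by (rule Max_in[OF T], rule Min_in[OF T])
  then have "Max ?T - Min ?T \<le> 2 * d" using bd[of "Max ?T"] bd[of "Min ?T"] by linarith
  moreover have "card ?T = card A + 1" using card_image[OF inj] A by simp
  ultimately show ?thesis by simp
qed

section \<open>Polynomials on the unit circle\<close>

text \<open>By Parseval this is the mean square of \<open>p\<close> on the unit circle. Summing only
  up to the degree keeps it independent of any ambient space of polynomials.\<close>

definition coeff_norm2 :: "complex poly \<Rightarrow> real" where
  "coeff_norm2 p = (\<Sum>i\<le>degree p. (cmod (coeff p i))\<^sup>2)"

lemma coeff_norm2_lessThan:
  assumes "degree p < M"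
  shows "coeff_norm2 p = (\<Sum>i<M. (cmod (coeff p i))\<^sup>2)"
  unfolding coeff_norm2_def using assms
  by (intro sum.mono_neutral_left) (auto simp: coeff_eq_0)

section \<open>A discrete Parseval identity and its consequences\<close>

lemma sum_cis_root_of_unity:
  fixes d :: int
  assumes M: "0 < M" and d: "\<bar>d\<bar> < int M"
  shows "(\<Sum>k<M. cis (2 * pi * real k * of_int d / real M)) = (if d = 0 then of_nat M else 0)"
proof (cases "d = 0")
  case False
  define w where "w = cis (2 * pi * of_int d / real M)"
  have pow: "cis (2 * pi * real k * of_int d / real M) = w ^ k" for k
    unfolding w_def by (subst Complex.DeMoivre) (simp add: mult_ac)
  have "w \<noteq> 1"
  proof
    assume "w = 1"
    then have "cos (2 * pi * of_int d / real M) = 1" by (simp add: w_def complex_eq_iff)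
    then obtain n :: int where "2 * pi * of_int d / real M = of_int n * 2 * pi"
      by (auto simp: cos_one_2pi_int)
    then have "real_of_int d = of_int (n * int M)" using M by (simp add: field_simps)
    then have "d = n * int M" by (simp only: of_int_eq_iff)
    moreover have "n \<noteq> 0" using calculation False by auto
    then have "1 * int M \<le> \<bar>n\<bar> * int M" by (intro mult_right_mono) auto
    ultimately show False using d by (simp add: abs_mult)
  qed
  moreover have "w ^ M = 1"
  proof -
    have "w ^ M = cis (2 * pi * of_int d)"
      unfolding w_def using M by (subst Complex.DeMoivre) simp
    then show ?thesis by simp
  qed
  ultimately show ?thesis using False by (simp add: pow geometric_sum)
qed simp

lemma cmod_sum_squared:
  fixes f :: "'a \<Rightarrow> complex"
  shows "complex_of_real ((cmod (\<Sum>i\<in>I. f i))\<^sup>2) = (\<Sum>i\<in>I. \<Sum>j\<in>I. f i * cnj (f j))"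
  by (simp only: complex_norm_square cnj_sum sum_product)

lemma sum_swap_innermost:
  "(\<Sum>a\<in>A. \<Sum>b\<in>B. \<Sum>j\<in>J. f a b j) = (\<Sum>j\<in>J. \<Sum>a\<in>A. \<Sum>b\<in>B. f a b j)"
proof -
  have "(\<Sum>b\<in>B. \<Sum>j\<in>J. f a b j) = (\<Sum>j\<in>J. \<Sum>b\<in>B. f a b j)" for a by (rule sum.swap)
  then show ?thesis by (simp only: sum.swap[of _ J A])
qed

text \<open>Sampling at the \<open>M\<close>-th roots of unity replaces the integral over the
  circle. It is exact because two exponents below \<open>M\<close> differ by less than
  \<open>M\<close>, so every off-diagonal sum vanishes.\<close>

lemma parseval:
  assumes "degree p < M"
  shows "(\<Sum>k<M. (cmod (poly p (cis (2 * pi * real k / real M))))\<^sup>2) = real M * coeff_norm2 p"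
proof -
  have M: "0 < M" using assms by simp
  define w where "w k = cis (2 * pi * real k / real M)" for k
  have ww: "w k ^ i * cnj (w k ^ j) = cis (2 * pi * real k * of_int (int i - int j) / real M)" for k i j
    unfolding w_def
    by (simp only: Complex.DeMoivre cis_cnj cis_mult) (simp add: diff_divide_distrib algebra_simps)
  have pw: "poly p (w k) = (\<Sum>i<M. coeff p i * w k ^ i)" for k
    unfolding poly_altdef using assms
    by (intro sum.mono_neutral_left) (auto simp: coeff_eq_0)
  have "complex_of_real (\<Sum>k<M. (cmod (poly p (w k)))\<^sup>2)
      = (\<Sum>k<M. \<Sum>i<M. \<Sum>j<M. coeff p i * w k ^ i * cnj (coeff p j * w k ^ j))"
    by (simp only: of_real_sum pw cmod_sum_squared)
  also have "\<dots> = (\<Sum>i<M. \<Sum>j<M. \<Sum>k<M. coeff p i * w k ^ i * cnj (coeff p j * w k ^ j))"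
    by (rule sum_swap_innermost[symmetric])
  also have "\<dots> = (\<Sum>i<M. \<Sum>j<M. coeff p i * cnj (coeff p j) * (\<Sum>k<M. w k ^ i * cnj (w k ^ j)))"
    by (intro sum.cong refl) (simp add: sum_distrib_left mult_ac)
  also have "\<dots> = (\<Sum>i<M. \<Sum>j<M. if i = j then coeff p i * cnj (coeff p j) * of_nat M else 0)"
  proof (intro sum.cong refl)
    fix i j assume "i \<in> {..<M}" "j \<in> {..<M}"
    then have "\<bar>int i - int j\<bar> < int M" by auto
    from sum_cis_root_of_unity[OF M this]
    show "coeff p i * cnj (coeff p j) * (\<Sum>k<M. w k ^ i * cnj (w k ^ j))
        = (if i = j then coeff p i * cnj (coeff p j) * of_nat M else 0)"
      by (simp only: ww) simp
  qed
  also have "\<dots> = (\<Sum>i<M. coeff p i * cnj (coeff p i) * of_nat M)"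
    by (intro sum.cong refl) (simp add: sum.delta)
  also have "\<dots> = complex_of_real (real M * coeff_norm2 p)"
    by (simp only: coeff_norm2_lessThan[OF assms] of_real_sum of_real_mult complex_norm_square
        sum_distrib_left) (simp add: mult_ac)
  finally show ?thesis by (simp only: of_real_eq_iff w_def)
qed

text \<open>With more sample points than the degree of the product, Parseval is exact for both
  \<open>p\<close> and \<open>p * q\<close>, and the bound for \<open>q\<close> can be applied at
  each sample.\<close>

lemma coeff_norm2_mult_le:
  assumes "\<And>w. cmod w = 1 \<Longrightarrow> (cmod (poly q w))\<^sup>2 \<le> C"
  shows "coeff_norm2 (p * q) \<le> C * coeff_norm2 p"
proof -
  define M where "M = degree p + degree q + 1"
  define w where "w k = cis (2 * pi * real k / real M)" for k
  have M: "degree p < M" "degree (p * q) < M" "0 < M"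
    using degree_mult_le[of p q] by (auto simp: M_def)
  have "real M * coeff_norm2 (p * q) = (\<Sum>k<M. (cmod (poly (p * q) (w k)))\<^sup>2)"
    using parseval[OF M(2)] by (simp add: w_def)
  also have "\<dots> \<le> (\<Sum>k<M. (cmod (poly p (w k)))\<^sup>2 * C)"
    by (intro sum_mono) (simp add: norm_mult power_mult_distrib mult_left_mono assms w_def)
  also have "\<dots> = C * (real M * coeff_norm2 p)"
  proof -
    have "(\<Sum>k<M. (cmod (poly p (w k)))\<^sup>2) = real M * coeff_norm2 p"
      using parseval[OF M(1)] by (simp only: w_def)
    then show ?thesis by (simp only: sum_distrib_right[symmetric]) simp
  qed
  finally show ?thesis using M(3) by simp
qed

lemma norm_cauchy_schwarz_sum:
  fixes f g :: "'a \<Rightarrow> complex"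
  shows "(cmod (\<Sum>i\<in>I. f i * g i))\<^sup>2 \<le> (\<Sum>i\<in>I. (cmod (f i))\<^sup>2) * (\<Sum>i\<in>I. (cmod (g i))\<^sup>2)"
proof -
  have "(cmod (\<Sum>i\<in>I. f i * g i))\<^sup>2 \<le> (\<Sum>i\<in>I. cmod (f i) * cmod (g i))\<^sup>2"
    by (intro power_mono order.trans[OF norm_sum]) (simp_all add: norm_mult)
  also have "\<dots> \<le> (\<Sum>i\<in>I. (cmod (f i))\<^sup>2) * (\<Sum>i\<in>I. (cmod (g i))\<^sup>2)"
    by (rule Cauchy_Schwarz_ineq_sum)
  finally show ?thesis .
qed

section \<open>Interpolation on a separated set\<close>

lemma diagonally_dominant_entry_le:
  fixes G :: "nat \<Rightarrow> nat \<Rightarrow> complex" and c :: "nat \<Rightarrow> complex"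
  assumes \<kappa>: "0 < \<kappa>" and diag: "\<And>i. i < n \<Longrightarrow> G i i = of_real \<kappa>"
    and off: "\<And>i. i < n \<Longrightarrow> (\<Sum>j\<in>{..<n} - {i}. cmod (G i j)) \<le> \<kappa> / 2"
    and b: "\<And>i. i < n \<Longrightarrow> cmod (\<Sum>j<n. G i j * c j) \<le> b" and "i < n"
  shows "cmod (c i) \<le> 2 * b / \<kappa>"
proof -
  define m where "m = Max ((\<lambda>i. cmod (c i)) ` {..<n})"
  have le: "cmod (c j) \<le> m" if "j < n" for j unfolding m_def using that by (intro Max_ge) auto
  have "m \<in> (\<lambda>i. cmod (c i)) ` {..<n}" unfolding m_def using \<open>i < n\<close> by (intro Max_in) auto
  \<comment> \<open>Row \<open>l\<close> belongs to the entry of largest modulus \<open>m\<close>: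
    there the off-diagonal part is at most half of the diagonal part, whence
    \<open>\<kappa> * m \<le> b + \<kappa> / 2 * m\<close>.\<close>
  then obtain l where l: "l < n" "cmod (c l) = m" by auto
  have "(\<Sum>j<n. G l j * c j) = of_real \<kappa> * c l + (\<Sum>j\<in>{..<n} - {l}. G l j * c j)"
    using l by (subst sum.remove[of _ l]) (auto simp: diag)
  then have "of_real \<kappa> * c l = (\<Sum>j<n. G l j * c j) - (\<Sum>j\<in>{..<n} - {l}. G l j * c j)" by simp
  then have "cmod (of_real \<kappa> * c l)
      \<le> cmod (\<Sum>j<n. G l j * c j) + cmod (\<Sum>j\<in>{..<n} - {l}. G l j * c j)"
    by (simp only: norm_triangle_ineq4)
  also have "cmod (\<Sum>j\<in>{..<n} - {l}. G l j * c j) \<le> (\<Sum>j\<in>{..<n} - {l}. cmod (G l j) * m)"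
    by (intro order.trans[OF norm_sum] sum_mono) (auto simp: norm_mult intro!: mult_left_mono le)
  also have "\<dots> = (\<Sum>j\<in>{..<n} - {l}. cmod (G l j)) * m" by (simp add: sum_distrib_right)
  also have "\<dots> \<le> \<kappa> / 2 * m"
    using off[OF l(1)] l(2) by (intro mult_right_mono) auto
  finally have "\<kappa> * m \<le> b + \<kappa> / 2 * m" using b[OF l(1)] l(2) \<kappa> by (simp add: norm_mult)
  then have "m \<le> 2 * b / \<kappa>" using \<kappa> by (simp add: field_simps)
  then show ?thesis using le[OF \<open>i < n\<close>] by simp
qed

text \<open>The entry bound serves twice: with \<open>b = 0\<close> it shows that the kernel is
  trivial, so the matrix is invertible, and with \<open>b = 1\<close> it bounds the
  solution.\<close>

lemma diagonally_dominant_solution: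
  fixes G :: "nat \<Rightarrow> nat \<Rightarrow> complex"
  assumes \<kappa>: "0 < \<kappa>" and diag: "\<And>i. i < n \<Longrightarrow> G i i = of_real \<kappa>"
    and off: "\<And>i. i < n \<Longrightarrow> (\<Sum>j\<in>{..<n} - {i}. cmod (G i j)) \<le> \<kappa> / 2"
  obtains c where "\<And>i. i < n \<Longrightarrow> (\<Sum>j<n. G i j * c j) = (if i = k then 1 else 0)"
    "\<And>i. i < n \<Longrightarrow> cmod (c i) \<le> 2 / \<kappa>"
proof -
  define A where "A = Matrix.mat n n (\<lambda>(i, j). G i j)"
  have A: "A \<in> carrier_mat n n" by (simp add: A_def)
  have mv: "vec_index (A *\<^sub>v v) i = (\<Sum>j<n. G i j * vec_index v j)" if "i < n" "v \<in> carrier_vec n" for i v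
    using that by (simp add: A_def scalar_prod_def atLeast0LessThan)
  have "Determinant.det A \<noteq> 0"
  proof
    assume "Determinant.det A = 0"
    then obtain v where v: "v \<in> carrier_vec n" "v \<noteq> 0\<^sub>v n" "A *\<^sub>v v = 0\<^sub>v n"
      using det_0_iff_vec_prod_zero_field[OF A] by blast
    have "cmod (vec_index v i) \<le> 2 * 0 / \<kappa>" if "i < n" for i
    proof (rule diagonally_dominant_entry_le[OF \<kappa> diag off _ that])
      show "cmod (\<Sum>j<n. G i j * vec_index v j) \<le> 0" if "i < n" for i
        using mv[OF that v(1)] v(3) that by simp
    qed
    then have "v = 0\<^sub>v n" using v(1) by (intro eq_vecI) auto
    then show False using v(2) by simp
  qed
  then obtain B where B: "B \<in> carrier_mat n n" "A * B = 1\<^sub>m n"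
    using det_non_zero_imp_unit[OF A, of "()"] by (auto simp: Units_def ring_mat_def)
  define e where "e = Matrix.vec n (\<lambda>i. if i = k then 1 else 0 :: complex)"
  define c where "c = vec_index (B *\<^sub>v e)"
  have Be: "B *\<^sub>v e \<in> carrier_vec n" using B by (simp add: e_def)
  have "A *\<^sub>v (B *\<^sub>v e) = e"
    using assoc_mult_mat_vec[OF A B(1), of e] B(2) by (simp add: e_def)
  then have c: "(\<Sum>j<n. G i j * c j) = (if i = k then 1 else 0)" if "i < n" for i
    using mv[OF that Be] that by (simp add: c_def e_def)
  show ?thesis
  proof (rule that[OF c])
    show "cmod (c i) \<le> 2 / \<kappa>" if "i < n" for i
      using diagonally_dominant_entry_le[OF \<kappa> diag off, where b = 1 and c = c and i = i] c that by simp
  qed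
qed

section \<open>Fejer kernels and interpolation by them\<close>

text \<open>\<open>L\<close> times the Fejer kernel, written as the inner product of the vectors
  \<open>(w\<^sup>a * cnj w\<^sup>b)\<^bsub>a, b < L\<^esub>\<close> and \<open>(u\<^sup>a * cnj u\<^sup>b)\<^bsub>a, b < L\<^esub>\<close>.\<close>

definition fejer :: "nat \<Rightarrow> complex \<Rightarrow> complex \<Rightarrow> complex" where
  "fejer L w u = (\<Sum>a<L. \<Sum>b<L. (w ^ a * cnj w ^ b) * (cnj u ^ a * u ^ b))"

lemma fejer_eq: "fejer L w u = of_real ((cmod (\<Sum>a<L. (w * cnj u) ^ a))\<^sup>2)"
  by (simp only: cmod_sum_squared fejer_def)
    (intro sum.cong refl, simp add: power_mult_distrib mult_ac)

text \<open>After division by \<open>u\<close> the kernel is the squared modulus of a geometric sum,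
  whose numerator has modulus at most 2.\<close>

lemma cmod_fejer_le:
  assumes "cmod w = 1" "cmod u = 1" "w \<noteq> u"
  shows "cmod (fejer L w u) \<le> 4 / (cmod (w - u))\<^sup>2"
proof -
  define v where "v = w * cnj u"
  have u: "u * cnj u = 1" using assms(2) complex_norm_square[of u] by simp
  have v1: "cmod v = 1" using assms by (simp add: v_def norm_mult)
  have wu: "w - u = u * (v - 1)"
    using u by (simp add: v_def algebra_simps)
  then have nv: "cmod (w - u) = cmod (v - 1)" using assms by (simp add: norm_mult)
  have "v \<noteq> 1" using wu assms(3) by auto
  then have "(\<Sum>a<L. v ^ a) = (v ^ L - 1) / (v - 1)" by (rule geometric_sum)
  moreover have "cmod (v ^ L - 1) \<le> 2"
    using norm_triangle_ineq4[of "v ^ L" 1] v1 by (simp add: norm_power)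
  then have "(cmod (v ^ L - 1))\<^sup>2 \<le> 2\<^sup>2" by (intro power_mono) auto
  moreover have "cmod (fejer L w u) = (cmod (\<Sum>a<L. v ^ a))\<^sup>2"
    by (simp only: fejer_eq norm_of_real v_def) simp
  ultimately show ?thesis
    unfolding nv by (simp add: norm_divide power_divide divide_right_mono)
qed

text \<open>Take the combination of the kernels at the nodes \<open>u j\<close> whose coefficients
  \<open>c\<close> solve the Gram system for the right-hand side \<open>k\<close>. By Cauchy-Schwarz
  its squared modulus on the circle is at most \<open>\<kappa>\<close> times the squared norm of the
  representing vector \<open>h\<close>. That squared norm is the quadratic form of \<open>c\<close>,
  which the Gram system collapses to a single coefficient of size at most
  \<open>2 / \<kappa>\<close>.\<close>

lemma fejer_interpolation:
  fixes u :: "nat \<Rightarrow> complex"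
  assumes L: "0 < L" and u: "\<And>i. i < n \<Longrightarrow> cmod (u i) = 1" and k: "k < n"
    and off: "\<And>i. i < n \<Longrightarrow> (\<Sum>j\<in>{..<n} - {i}. cmod (fejer L (u i) (u j))) \<le> (real L)\<^sup>2 / 2"
  obtains p where "degree p \<le> 2 * (L - 1)" "\<And>i. i < n \<Longrightarrow> poly p (u i) = (if i = k then 1 else 0)"
    "\<And>w. cmod w = 1 \<Longrightarrow> (cmod (poly p w))\<^sup>2 \<le> 2"
proof -
  define \<kappa> where "\<kappa> = (real L)\<^sup>2"
  have \<kappa>: "0 < \<kappa>" using L by (simp add: \<kappa>_def)
  have unit: "w * cnj w = 1" if "cmod w = 1" for w using complex_norm_square[of w] that by simp
  have diag: "fejer L w w = of_real \<kappa>" if "cmod w = 1" for w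
    using unit[OF that] by (simp add: fejer_eq \<kappa>_def)
  obtain c where c: "\<And>i. i < n \<Longrightarrow> (\<Sum>j<n. fejer L (u i) (u j) * c j) = (if i = k then 1 else 0)"
    and cle: "\<And>i. i < n \<Longrightarrow> cmod (c i) \<le> 2 / \<kappa>"
  proof (rule diagonally_dominant_solution[of \<kappa> n "\<lambda>i j. fejer L (u i) (u j)" k])
    show "fejer L (u i) (u i) = of_real \<kappa>" if "i < n" for i using diag[OF u[OF that]] .
  qed (use \<kappa> off that in \<open>auto simp: \<kappa>_def\<close>)
  define h where "h a b = (\<Sum>j<n. c j * (cnj (u j) ^ a * u j ^ b))" for a b
  \<comment> \<open>On the circle the combination has exponents from \<open>-(L - 1)\<close> to
    \<open>L - 1\<close>. Multiplication by the power \<open>L - 1\<close> makes it a polynomial,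
    and the constant in front restores the value 1 at \<open>u k\<close>. Neither changes the
    modulus on the circle.\<close>
  define p where "p = smult (cnj (u k) ^ (L - 1))
    (\<Sum>a<L. \<Sum>b<L. monom (h a b) (L - 1 + a - b))"
  have pw: "poly p w = cnj (u k) ^ (L - 1) * w ^ (L - 1) * (\<Sum>j<n. fejer L w (u j) * c j)"
    if w: "cmod w = 1" for w
  proof -
    have "w ^ (L - 1 + a - b) = w ^ (L - 1) * (w ^ a * cnj w ^ b)" if "b < L" for a b
    proof -
      have "w ^ (L - 1 + a - b) * (w ^ b * cnj w ^ b) = w ^ (L - 1 + a - b + b) * cnj w ^ b"
        by (simp add: power_add)
      also have "L - 1 + a - b + b = L - 1 + a" using that by simp
      finally show ?thesis using unit[OF w] by (simp add: power_add mult_ac flip: power_mult_distrib)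
    qed
    then have "poly p w = cnj (u k) ^ (L - 1) * (\<Sum>a<L. \<Sum>b<L. h a b * (w ^ (L - 1) * (w ^ a * cnj w ^ b)))"
      by (simp add: p_def poly_sum poly_monom)
    also have "(\<Sum>a<L. \<Sum>b<L. h a b * (w ^ (L - 1) * (w ^ a * cnj w ^ b)))
        = w ^ (L - 1) * (\<Sum>a<L. \<Sum>b<L. h a b * (w ^ a * cnj w ^ b))"
      by (simp add: sum_distrib_left mult_ac)
    also have "(\<Sum>a<L. \<Sum>b<L. h a b * (w ^ a * cnj w ^ b)) = (\<Sum>j<n. fejer L w (u j) * c j)"
      unfolding h_def fejer_def sum_distrib_right sum_distrib_left sum_swap_innermost[of _ "{..<L}"]
      by (simp only: mult_ac)
    finally show ?thesis by (simp add: mult_ac)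
  qed
  show ?thesis
  proof (rule that[of p])
    show "degree p \<le> 2 * (L - 1)"
      unfolding p_def
      by (intro order.trans[OF degree_smult_le] degree_sum_le order.trans[OF degree_monom_le]) auto
    show "poly p (u i) = (if i = k then 1 else 0)" if i: "i < n" for i
    proof -
      have "cnj (u k) ^ (L - 1) * u k ^ (L - 1) = 1"
        using unit[OF u[OF k]] by (simp add: mult.commute flip: power_mult_distrib)
      then show ?thesis using pw[OF u[OF i]] c[OF i] by simp
    qed
    fix w assume w: "cmod w = 1"
    let ?I = "{..<L} \<times> {..<L}"
    have "(\<Sum>j<n. fejer L w (u j) * c j) = (\<Sum>(a, b)\<in>?I. (w ^ a * cnj w ^ b) * h a b)"
      unfolding h_def fejer_def sum_distrib_right sum_distrib_left sum.cartesian_product[symmetric]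
        sum_swap_innermost[of _ "{..<L}"]
      by (simp only: mult_ac)
    then have "(cmod (poly p w))\<^sup>2 = (cmod (\<Sum>x\<in>?I. (w ^ fst x * cnj w ^ snd x) * h (fst x) (snd x)))\<^sup>2"
      using pw[OF w] w u[OF k] by (simp add: norm_mult norm_power case_prod_beta)
    also have "\<dots> \<le> (\<Sum>x\<in>?I. (cmod (w ^ fst x * cnj w ^ snd x))\<^sup>2) * (\<Sum>x\<in>?I. (cmod (h (fst x) (snd x)))\<^sup>2)"
      by (rule norm_cauchy_schwarz_sum)
    also have "(\<Sum>x\<in>?I. (cmod (w ^ fst x * cnj w ^ snd x))\<^sup>2) = \<kappa>"
      using w by (simp add: norm_mult norm_power \<kappa>_def power2_eq_square)
    also have "(\<Sum>x\<in>?I. (cmod (h (fst x) (snd x)))\<^sup>2) \<le> 2 / \<kappa>"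
    proof -
      have "complex_of_real (\<Sum>x\<in>?I. (cmod (h (fst x) (snd x)))\<^sup>2)
          = (\<Sum>a<L. \<Sum>b<L. \<Sum>i<n. \<Sum>j<n.
              (c i * (cnj (u i) ^ a * u i ^ b)) * cnj (c j * (cnj (u j) ^ a * u j ^ b)))"
      proof -
        have "(\<Sum>x\<in>?I. (cmod (h (fst x) (snd x)))\<^sup>2) = (\<Sum>a<L. \<Sum>b<L. (cmod (h a b))\<^sup>2)"
          by (simp add: sum.cartesian_product case_prod_beta)
        then show ?thesis by (simp only: of_real_sum h_def cmod_sum_squared)
      qed
      also have "\<dots> = (\<Sum>i<n. \<Sum>j<n. \<Sum>a<L. \<Sum>b<L.
              (c i * (cnj (u i) ^ a * u i ^ b)) * cnj (c j * (cnj (u j) ^ a * u j ^ b)))"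
        by (simp only: sum_swap_innermost[of _ "{..<n}" "{..<L}" "{..<L}"]
            sum_swap_innermost[of _ "{..<L}" "{..<L}" "{..<n}"])
      \<comment> \<open>The inner sums over \<open>a\<close> and \<open>b\<close> are again Fejer
        kernels, so the squared norm of \<open>h\<close> is the quadratic form of the Gram matrix at
        \<open>c\<close>.\<close>
      also have "\<dots> = (\<Sum>j<n. cnj (c j) * (\<Sum>i<n. fejer L (u j) (u i) * c i))"
        unfolding fejer_def sum_distrib_right sum_distrib_left
        by (subst sum.swap) (simp add: mult_ac)
      also have "\<dots> = (\<Sum>j<n. if j = k then cnj (c j) else 0)"
        by (intro sum.cong refl) (simp add: c)
      also have "\<dots> = cnj (c k)" using k by simp
      finally have "(\<Sum>x\<in>?I. (cmod (h (fst x) (snd x)))\<^sup>2) = Re (cnj (c k))"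
        by (metis Re_complex_of_real)
      also have "\<dots> \<le> 2 / \<kappa>" using complex_Re_le_cmod[of "c k"] cle[OF k] by simp
      finally show ?thesis .
    qed
    then have "\<kappa> * (\<Sum>x\<in>?I. (cmod (h (fst x) (snd x)))\<^sup>2) \<le> \<kappa> * (2 / \<kappa>)"
      using \<kappa> by (intro mult_left_mono) auto
    finally show "(cmod (poly p w))\<^sup>2 \<le> 2" using \<kappa> by simp
  qed
qed

text \<open>Each off-diagonal kernel value is at most an inverse squared sine, so a row sums to at
  most half of the inverse square of \<tau>. Diagonal dominance then asks for \<open>L\<close> at
  least \<open>1 / \<tau>\<close>, and rounding up keeps the degree \<open>2 * (L - 1)\<close> below
  \<open>2 / \<tau>\<close>.\<close>

lemma separated_interpolation:
  assumes Y: "finite Y" "y \<in> Y" and \<tau>: "0 < \<tau>" "\<tau> < 1"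
    and sep: "\<And>u v. u \<in> Y \<Longrightarrow> v \<in> Y \<Longrightarrow> u \<noteq> v \<Longrightarrow> \<tau> \<le> torus_norm (u - v)"
  obtains p where "real (degree p) \<le> 2 / \<tau>"
    "\<And>u. u \<in> Y \<Longrightarrow> poly p (torus_char 1 u) = (if u = y then 1 else 0)"
    "\<And>w. cmod w = 1 \<Longrightarrow> (cmod (poly p w))\<^sup>2 \<le> 2"
proof -
  define L where "L = nat \<lceil>1 / \<tau>\<rceil>"
  have L: "1 / \<tau> \<le> real L" "real L < 1 / \<tau> + 1" "0 < L"
    using \<tau> unfolding L_def by (simp_all, linarith+)
  define n where "n = card Y"
  obtain e where e: "bij_betw e {..<n} Y"
    using ex_bij_betw_nat_finite[OF Y(1)] by (auto simp: n_def atLeast0LessThan)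
  have eY: "e i \<in> Y" if "i < n" for i using bij_betwE[OF e] that by auto
  have einj: "e i = e j \<longleftrightarrow> i = j" if "i < n" "j < n" for i j
    using bij_betw_imp_inj_on[OF e] that by (auto simp: inj_on_def)
  have surj: "\<exists>i<n. u = e i" if "u \<in> Y" for u
    using bij_betw_imp_surj_on[OF e] that by auto
  obtain k where k: "k < n" "y = e k" using surj[OF Y(2)] by auto
  define z where "z i = torus_char 1 (e i)" for i
  have off: "(\<Sum>j\<in>{..<n} - {i}. cmod (fejer L (z i) (z j))) \<le> (real L)\<^sup>2 / 2" if i: "i < n" for i
  proof -
    have "(\<Sum>j\<in>{..<n} - {i}. cmod (fejer L (z i) (z j)))
        \<le> (\<Sum>j\<in>{..<n} - {i}. 1 / (sin (pi * torus_norm (e j - e i)))\<^sup>2)"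
    proof (rule sum_mono)
      fix j assume "j \<in> {..<n} - {i}"
      then have j: "j < n" "j \<noteq> i" by auto
      have d: "0 < torus_norm (e j - e i)" "torus_norm (e j - e i) \<le> 1 / 2"
        using sep[of "e j" "e i"] eY einj i j \<tau> torus_norm_le_half[of "e j - e i"] by fastforce+
      then have "sin (pi * torus_norm (e j - e i)) > 0" by (intro sin_gt_zero) auto
      then have nz: "cmod (z i - z j) = 2 * sin (pi * torus_norm (e j - e i))"
        "0 < sin (pi * torus_norm (e j - e i))"
        by (auto simp: z_def torus_norm_minus_commute[of "e i"] cmod_torus_char_diff
            simp del: One_nat_def)
      then have "z i \<noteq> z j" by auto
      then have "cmod (fejer L (z i) (z j)) \<le> 4 / (cmod (z i - z j))\<^sup>2"
        by (intro cmod_fejer_le) (auto simp: z_def)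
      then show "cmod (fejer L (z i) (z j)) \<le> 1 / (sin (pi * torus_norm (e j - e i)))\<^sup>2"
        by (simp add: nz(1) power_mult_distrib)
    qed
    also have "\<dots> = (\<Sum>u\<in>Y - {e i}. 1 / (sin (pi * torus_norm (u - e i)))\<^sup>2)"
    proof (rule sum.reindex_bij_betw)
      show "bij_betw e ({..<n} - {i}) (Y - {e i})"
        using e i by (auto simp: bij_betw_def inj_on_def)
    qed
    also have "\<dots> \<le> 1 / (2 * \<tau>\<^sup>2)"
      by (rule torus_sum_inverse_sin_squared_le[OF Y(1) \<tau> eY[OF i] sep])
    also have "\<dots> = (1 / \<tau>)\<^sup>2 / 2" by (simp add: power_divide)
    also have "\<dots> \<le> (real L)\<^sup>2 / 2"
      using L(1) \<tau> by (intro divide_right_mono power_mono) auto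
    finally show ?thesis .
  qed
  obtain p where p: "degree p \<le> 2 * (L - 1)" "\<And>i. i < n \<Longrightarrow> poly p (z i) = (if i = k then 1 else 0)"
    "\<And>w. cmod w = 1 \<Longrightarrow> (cmod (poly p w))\<^sup>2 \<le> 2"
    by (rule fejer_interpolation[OF L(3) _ k(1) off]) (auto simp: z_def)
  show ?thesis
  proof (rule that[OF _ _ p(3)])
    have "real (degree p) \<le> real (2 * (L - 1))" using p(1) by (simp only: of_nat_le_iff)
    then show "real (degree p) \<le> 2 / \<tau>" using L by (simp add: of_nat_diff)
    show "poly p (torus_char 1 u) = (if u = y then 1 else 0)" if "u \<in> Y" for u
      using surj[OF that] k einj p(2) by (auto simp: z_def)
  qed
qed

section \<open>Interpolation at the far points\<close>

lemma greedy_colouring: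
  assumes "finite U" and sym: "\<And>u v. R u v \<Longrightarrow> R v u" and refl: "\<And>u. R u u"
    and "\<And>u. u \<in> U \<Longrightarrow> card {v \<in> U. R u v} \<le> \<nu>"
  shows "\<exists>c. (\<forall>u\<in>U. c u < \<nu>) \<and> (\<forall>u\<in>U. \<forall>v\<in>U. R u v \<longrightarrow> u \<noteq> v \<longrightarrow> c u \<noteq> (c v :: nat))"
  using assms(1,4)
proof (induction U rule: finite_induct)
  case (insert x U)
  have deg: "card {v \<in> U. R u v} \<le> \<nu>" if "u \<in> U" for u
  proof -
    have "card {v \<in> U. R u v} \<le> card {v \<in> insert x U. R u v}"
      using insert.hyps(1) by (intro card_mono) auto
    then show ?thesis using insert.prems[of u] that by simp
  qed
  have "\<exists>c. (\<forall>u\<in>U. c u < \<nu>) \<and> (\<forall>u\<in>U. \<forall>v\<in>U. R u v \<longrightarrow> u \<noteq> v \<longrightarrow> c u \<noteq> (c v :: nat))"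
    by (rule insert.IH) (rule deg)
  then obtain c where
    c: "\<forall>u\<in>U. c u < \<nu>" "\<forall>u\<in>U. \<forall>v\<in>U. R u v \<longrightarrow> u \<noteq> v \<longrightarrow> c u \<noteq> (c v :: nat)"
    by (elim exE conjE)
  \<comment> \<open>Reflexivity counts \<open>x\<close> among its own neighbours, so at most
    \<open>\<nu> - 1\<close> colours are taken by the others and one of the \<open>\<nu>\<close>
    colours remains free.\<close>
  have "{v \<in> insert x U. R x v} = insert x {v \<in> U. R x v}" using refl by auto
  then have "Suc (card {v \<in> U. R x v}) \<le> \<nu>"
    using insert.prems[of x] insert.hyps by simp
  then have "card (c ` {v \<in> U. R x v}) < card {..<\<nu>}"
    using card_image_le[of "{v \<in> U. R x v}" c] insert.hyps(1) by simp
  moreover have "finite (c ` {v \<in> U. R x v})" using insert.hyps(1) by simp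
  ultimately have "\<not> {..<\<nu>} \<subseteq> c ` {v \<in> U. R x v}" using card_mono not_less by blast
  then obtain a where a: "a < \<nu>" "a \<notin> c ` {v \<in> U. R x v}" by blast
  show ?case
    using a c insert.hyps(2) sym by (intro exI[of _ "c(x := a)"]) auto
qed auto

lemma near_points_card_le_local_sparsity:
  assumes "finite U" "u \<in> U"
  shows "card (near_points u \<tau> U) \<le> local_sparsity \<tau> U"
  using assms by (auto simp: local_sparsity_def intro!: Max_ge)

lemma local_sparsity_mono:
  assumes "U \<subseteq> V" "finite V"
  shows "local_sparsity \<tau> U \<le> local_sparsity \<tau> V"
proof (cases "U = {}")
  case False
  have U: "finite U" using assms finite_subset by blast
  have "card (near_points u \<tau> U) \<le> local_sparsity \<tau> V" if "u \<in> U" for u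
  proof -
    have "card (near_points u \<tau> U) \<le> card (near_points u \<tau> V)"
      using assms by (intro card_mono) (auto simp: near_points_def)
    then show ?thesis using near_points_card_le_local_sparsity[of V u \<tau>] assms that by force
  qed
  then show ?thesis using False U by (subst local_sparsity_def) auto
qed (simp add: local_sparsity_def)

text \<open>Colour the far nodes so that nodes within \<tau> of each other differ. Each class
  together with \<open>y\<close> is \<tau>-separated and has a polynomial that is 1 at
  \<open>y\<close> and 0 on the class. The product over the classes vanishes at every far node, with
  one factor 2 in the squared modulus and one summand \<open>2 / \<tau>\<close> in the degree per
  class.\<close>

lemma far_points_interpolation:
  assumes G: "finite G" and \<tau>: "0 < \<tau>" "\<tau> < 1"
    and far: "\<And>u. u \<in> G \<Longrightarrow> \<tau> < torus_norm (u - y)"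
  obtains p where "real (degree p) \<le> 2 * real (local_sparsity \<tau> G) / \<tau>"
    "poly p (torus_char 1 y) = 1" "\<And>u. u \<in> G \<Longrightarrow> poly p (torus_char 1 u) = 0"
    "\<And>w. cmod w = 1 \<Longrightarrow> (cmod (poly p w))\<^sup>2 \<le> 2 ^ local_sparsity \<tau> G"
proof -
  define \<nu> where "\<nu> = local_sparsity \<tau> G"
  obtain c where c: "\<forall>u\<in>G. c u < \<nu>"
    "\<forall>u\<in>G. \<forall>v\<in>G. torus_norm (u - v) \<le> \<tau> \<longrightarrow> u \<noteq> v \<longrightarrow> c u \<noteq> (c v :: nat)"
    using greedy_colouring[of G "\<lambda>u v. torus_norm (u - v) \<le> \<tau>" \<nu>] G \<tau> torus_norm_0 torus_norm_minus_commute
      near_points_card_le_local_sparsity[OF G, of _ \<tau>]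
    by (fastforce simp: \<nu>_def near_points_def)
  have "\<exists>p. real (degree p) \<le> 2 / \<tau>
    \<and> (\<forall>u\<in>insert y {v \<in> G. c v = a}. poly p (torus_char 1 u) = (if u = y then 1 else 0))
    \<and> (\<forall>w. cmod w = 1 \<longrightarrow> (cmod (poly p w))\<^sup>2 \<le> 2)" for a
  proof (rule separated_interpolation[of "insert y {v \<in> G. c v = a}" y \<tau>])
    fix u v assume uv: "u \<in> insert y {v \<in> G. c v = a}" "v \<in> insert y {v \<in> G. c v = a}" "u \<noteq> v"
    show "\<tau> \<le> torus_norm (u - v)"
    proof (cases "u = y \<or> v = y")
      case True
      then show ?thesis using uv far[of u] far[of v] torus_norm_minus_commute[of u v] by auto
    next
      case False
      then show ?thesis using uv c(2) by force
    qed
  qed (use G \<tau> in auto)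
  then have "\<exists>P. \<forall>a. real (degree (P a)) \<le> 2 / \<tau>
    \<and> (\<forall>u\<in>insert y {v \<in> G. c v = a}. poly (P a) (torus_char 1 u) = (if u = y then 1 else 0))
    \<and> (\<forall>w. cmod w = 1 \<longrightarrow> (cmod (poly (P a) w))\<^sup>2 \<le> 2)"
    by (intro choice allI)
  then obtain P where P': "\<forall>a. real (degree (P a)) \<le> 2 / \<tau>
    \<and> (\<forall>u\<in>insert y {v \<in> G. c v = a}. poly (P a) (torus_char 1 u) = (if u = y then 1 else 0))
    \<and> (\<forall>w. cmod w = 1 \<longrightarrow> (cmod (poly (P a) w))\<^sup>2 \<le> 2)" ..
  have P: "real (degree (P a)) \<le> 2 / \<tau>"
    "u \<in> insert y {v \<in> G. c v = a} \<Longrightarrow> poly (P a) (torus_char 1 u) = (if u = y then 1 else 0)"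
    "cmod w = 1 \<Longrightarrow> (cmod (poly (P a) w))\<^sup>2 \<le> 2" for a u w
    using P' by blast+
  define p where "p = (\<Prod>a<\<nu>. P a)"
  show ?thesis
  proof (rule that[of p])
    have "real (degree p) \<le> (\<Sum>a<\<nu>. real (degree (P a)))"
      using degree_prod_sum_le[of "{..<\<nu>}" P] by (simp add: p_def o_def flip: of_nat_sum)
    also have "\<dots> \<le> (\<Sum>a<\<nu>. 2 / \<tau>)" by (intro sum_mono P)
    finally show "real (degree p) \<le> 2 * real (local_sparsity \<tau> G) / \<tau>"
      by (simp add: \<nu>_def mult_ac)
    show "poly p (torus_char 1 y) = 1" by (simp add: p_def poly_prod P(2) del: One_nat_def)
    show "poly p (torus_char 1 u) = 0" if u: "u \<in> G" for u
    proof -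
      have "u \<noteq> y" using far[OF u] torus_norm_0 \<tau> by auto
      then have "poly (P (c u)) (torus_char 1 u) = 0" using P(2)[of u "c u"] u by auto
      then show ?thesis using c(1) u by (auto simp: p_def poly_prod)
    qed
    fix w assume w: "cmod w = 1"
    have "(cmod (poly p w))\<^sup>2 = (\<Prod>a<\<nu>. (cmod (poly (P a) w))\<^sup>2)"
      by (simp add: p_def poly_prod prod_power_distrib flip: prod_norm)
    also have "\<dots> \<le> (\<Prod>a<\<nu>. 2)" using P(3)[OF w] by (intro prod_mono) auto
    finally show "(cmod (poly p w))\<^sup>2 \<le> 2 ^ local_sparsity \<tau> G" by (simp add: \<nu>_def)
  qed
qed

section \<open>Interpolation at the near points\<close>

text \<open>A Stirling type inequality that trades the factorial produced by the nearest-node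
  ordering for powers of \<open>2 * exp 1\<close>. The induction multiplies the left side by
  \<open>pi / 2 * (r + 1) * (1 + 1 / r) ^ r\<close>, where the last power is at most e.\<close>

lemma pi_power_le_fact:
  assumes "1 \<le> r"
  shows "(pi * real r / 2) ^ (r - 1) * (real r * pi) \<le> fact (r - 1) * (2 * exp 1) ^ r"
proof -
  \<comment> \<open>The cases up to \<open>r = 4\<close> are numerical and rest on this
    comparison.\<close>
  have e: "pi \<le> 7 / 6 * exp 1" using pi_approx(2) abs_le_D2[OF e_approx_32] by simp
  have pe: "pi ^ k \<le> (7 / 6) ^ k * exp 1 ^ k" for k :: nat
    using power_mono[OF e pi_ge_zero, of k] by (simp only: power_mult_distrib)
  have e0: "(0::real) \<le> exp 1 ^ k" for k :: nat by simp
  consider "r = 1" | "r = 2" | "r = 3" | "r \<ge> 4" using assms by linarith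
  then show ?thesis
  proof cases
    case 1
    have "pi \<le> 2 * exp 1" using e e0[of 1] by (simp only: power_one_right)
    then show ?thesis using 1 by simp
  next
    case 2
    have "2 * pi ^ 2 \<le> 4 * exp 1 ^ 2"
      proof -
        have "pi ^ 2 \<le> 49 / 36 * exp 1 ^ 2" using pe[of 2] by (simp add: power_divide)
        then show ?thesis using e0[of 2] by linarith
      qed
    then show ?thesis using 2 by (simp add: power2_eq_square mult_ac)
  next
    case 3
    have "27 / 4 * pi ^ 3 \<le> 16 * exp 1 ^ 3"
      proof -
        have "pi ^ 3 \<le> 343 / 216 * exp 1 ^ 3" using pe[of 3] by (simp add: power_divide)
        then show ?thesis using e0[of 3] by linarith
      qed
    then show ?thesis using 3
      by (simp add: fact_numeral power_mult_distrib power_divide power2_eq_square power3_eq_cube mult_ac)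
  next
    case 4
    then show ?thesis
    proof (induction r rule: nat_induct_at_least)
      case base
      have "32 * pi ^ 4 \<le> 96 * exp 1 ^ 4"
        proof -
        have "pi ^ 4 \<le> 2401 / 1296 * exp 1 ^ 4" using pe[of 4] by (simp add: power_divide)
        then show ?thesis using e0[of 4] by linarith
      qed
      moreover have "(pi * real 4 / 2) ^ (4 - 1) * (real 4 * pi) = 32 * pi ^ 4"
        by (simp add: power_mult_distrib power3_eq_cube power4_eq_xxxx)
      moreover have "fact (4 - 1) * (2 * exp 1) ^ 4 = (96 * exp 1 ^ 4 :: real)"
        by (simp add: power_mult_distrib fact_numeral)
      ultimately show ?case by simp
    next
      case (Suc r)
      have r: "0 < real r" using Suc.hyps by simp
      have "(1 + 1 / real r) ^ r \<le> exp (1 / real r) ^ r" by (intro power_mono exp_ge_add_one_self) auto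
      also have "\<dots> = exp 1" using r by (simp flip: exp_of_nat_mult)
      finally have ex: "(1 + 1 / real r) ^ r \<le> exp 1" .
      \<comment> \<open>The induction step requires \<open>pi * (r + 1) \<le> 4 * r\<close>, which
        fails at 3 and holds from 4 on; hence the base case 4.\<close>
      have "pi * (real r + 1) \<le> 32 / 10 * (real r + 1)"
        using pi_approx(2) by (intro mult_right_mono) auto
      then have "pi * (real r + 1) \<le> 4 * real r" using Suc.hyps by simp
      then have st: "pi / 2 * (real r + 1) * (1 + 1 / real r) ^ r \<le> 2 * real r * exp 1"
        using mult_mono[OF _ ex, of "pi / 2 * (real r + 1)" "2 * real r"] by simp
      have "pi * real (Suc r) / 2 = (pi * real r / 2) * (1 + 1 / real r)"
        using r by (simp add: field_simps)
      then have p1: "(pi * real (Suc r) / 2) ^ (Suc r - 1) = (pi * real r / 2) ^ r * (1 + 1 / real r) ^ r"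
        by (simp only: diff_Suc_1 power_mult_distrib)
      have p2: "(pi * real r / 2) ^ r = (pi * real r / 2) ^ (r - 1) * (pi * real r / 2)"
        using Suc.hyps by (cases r) auto
      have "(pi * real (Suc r) / 2) ^ (Suc r - 1) * (real (Suc r) * pi)
          = ((pi * real r / 2) ^ (r - 1) * (real r * pi)) * (pi / 2 * (real r + 1) * (1 + 1 / real r) ^ r)"
        unfolding p1 p2 by (simp add: algebra_simps)
      also have "\<dots> \<le> (fact (r - 1) * (2 * exp 1) ^ r) * (2 * real r * exp 1)"
        by (rule mult_mono[OF Suc.IH st]) (use r in auto)
      also have "\<dots> = fact (Suc r - 1) * (2 * exp 1) ^ Suc r"
        using Suc.hyps by (cases r) (auto simp: algebra_simps)
      finally show ?case .
    qed
  qed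
qed

section \<open>Building blocks for the near nodes\<close>

lemma floor_ratio_divide:
  "floor_ratio (real n / real r) = real n / (real r * real (n div r))"
  by (simp add: floor_ratio_def floor_divide_of_nat_eq)

text \<open>By Cauchy-Schwarz, \<open>1 / q\<close> is the least squared coefficient norm of a
  polynomial of degree below \<open>q\<close> with value 1 at \<open>z\<close>; the normalised
  Dirichlet kernel attains it.\<close>

lemma dirichlet_kernel:
  assumes "0 < q" "cmod z = 1"
  obtains p where "degree p < q" "poly p z = 1" "coeff_norm2 p = 1 / real q"
proof -
  define p where "p = (\<Sum>i<q. monom (cnj z ^ i / of_nat q) i)"
  have c: "coeff p i = (if i < q then cnj z ^ i / of_nat q else 0)" for i
    by (simp add: p_def coeff_sum coeff_monom sum.delta)
  have d: "degree p < q"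
  proof -
    have "degree p \<le> q - 1" unfolding p_def
      by (intro degree_sum_le order.trans[OF degree_monom_le]) auto
    then show ?thesis using assms(1) by simp
  qed
  have "cnj z * z = 1" using complex_norm_square[of z] assms(2) by (simp add: mult.commute)
  then have "poly p z = 1"
    using assms(1) by (simp add: p_def poly_sum poly_monom flip: power_mult_distrib)
  moreover have "coeff_norm2 p = (\<Sum>i<q. (1 / real q)\<^sup>2)"
    unfolding coeff_norm2_lessThan[OF d]
    by (intro sum.cong refl) (simp add: c norm_divide norm_power assms)
  ultimately show ?thesis using d assms(1) by (intro that[of p]) (auto simp: power2_eq_square)
qed

text \<open>Compared with a linear factor, the binomial of degree \<open>f\<close> still has modulus
  at most 2 on the circle, while a suitable \<open>f\<close> enlarges the denominator for close
  nodes.\<close>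

lemma sparse_linear_factor:
  assumes "cmod z = 1" "cmod u = 1" "z ^ f \<noteq> u ^ f"
  obtains p where "degree p \<le> f" "poly p z = 1" "poly p u = 0"
    "\<And>w. cmod w = 1 \<Longrightarrow> cmod (poly p w) \<le> 2 / cmod (z ^ f - u ^ f)"
proof -
  define p where "p = smult (1 / (z ^ f - u ^ f)) (monom 1 f - [:u ^ f:])"
  show ?thesis
  proof (rule that[of p])
    show "degree p \<le> f"
      unfolding p_def by (intro order.trans[OF degree_smult_le] degree_diff_le) (auto simp: degree_monom_eq)
    show "cmod (poly p w) \<le> 2 / cmod (z ^ f - u ^ f)" if "cmod w = 1" for w
    proof -
      have "cmod (w ^ f - u ^ f) \<le> 2"
        using norm_triangle_ineq4[of "w ^ f" "u ^ f"] that assms by (simp add: norm_power)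
      then show ?thesis by (simp add: p_def poly_monom norm_divide norm_mult divide_right_mono)
    qed
  qed (use assms in \<open>auto simp: p_def poly_monom\<close>)
qed

text \<open>The induction adds the nodes in order of increasing distance from \<open>y\<close>. When
  the \<open>j\<close>-th node is added it is the farthest so far, so its distance is at least
  \<open>j * \<delta> / 2\<close> and it contributes \<open>K / j\<close>; these factors build the
  factorial.\<close>

lemma prod_le_power_div_fact:
  fixes \<sigma> :: "torus \<Rightarrow> real"
  assumes "finite A" "y \<notin> A" "card A \<le> r"
    and sep: "\<And>u v. u \<in> insert y A \<Longrightarrow> v \<in> insert y A \<Longrightarrow> u \<noteq> v \<Longrightarrow> \<delta> \<le> torus_norm (u - v)"
    and \<delta>: "0 < \<delta>" and K: "0 \<le> K"
    and pos: "\<And>u. u \<in> A \<Longrightarrow> 0 < \<sigma> u"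
    and \<sigma>: "\<And>u j. u \<in> A \<Longrightarrow> 1 \<le> j \<Longrightarrow> j \<le> r \<Longrightarrow> real j * \<delta> \<le> 2 * torus_norm (u - y)
      \<Longrightarrow> 1 / \<sigma> u \<le> K / real j"
  shows "(\<Prod>u\<in>A. 1 / \<sigma> u) \<le> K ^ card A / fact (card A)"
  using assms(1-4) pos \<sigma>
proof (induction A rule: finite_ranking_induct[where f = "\<lambda>u. torus_norm (u - y)"])
  case (insert x A)
  show ?case
  proof (cases "x \<in> A")
    case True
    then show ?thesis using insert by (simp add: insert_absorb)
  next
    case False
    have IH: "(\<Prod>u\<in>A. 1 / \<sigma> u) \<le> K ^ card A / fact (card A)"
      using insert.prems insert.hyps(1) False by (intro insert.IH) auto
    have c: "card (insert x A) = Suc (card A)" using False insert.hyps by simp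
    have "real (card (insert x A)) * \<delta> \<le> 2 * torus_norm (x - y)"
      using insert.hyps insert.prems \<delta> torus_norm_nonneg
      by (intro farthest_point_distance[where y = y]) auto
    then have x: "0 < \<sigma> x" "1 / \<sigma> x \<le> K / real (Suc (card A))"
      using insert.prems(4)[of x] insert.prems(5)[of x "Suc (card A)"] insert.prems(2) c by auto
    have "(\<Prod>u\<in>insert x A. 1 / \<sigma> u) = 1 / \<sigma> x * (\<Prod>u\<in>A. 1 / \<sigma> u)"
      using False insert.hyps by simp
    also have "\<dots> \<le> K / real (Suc (card A)) * (K ^ card A / fact (card A))"
      using x IH K insert.prems(4) by (intro mult_mono prod_nonneg) (auto intro: less_imp_le)
    also have "\<dots> = K ^ card (insert x A) / fact (card (insert x A))"
      by (simp add: c)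
    finally show ?thesis .
  qed
qed simp

text \<open>One Dirichlet kernel of degree below \<open>q\<close> and \<open>r - 1\<close> sparse
  factors of degree at most \<open>q\<close> stay below degree \<open>r * q \<le> n\<close>. The
  kernel supplies the coefficient norm \<open>1 / q\<close>; the factors enter through their maximum
  on the circle.\<close>

lemma near_points_interpolation:
  fixes n r :: nat and \<delta> :: real
  assumes B: "finite B" "y \<in> B" "card B = r" and \<delta>: "0 < \<delta>"
    and sep: "\<And>u v. u \<in> B \<Longrightarrow> v \<in> B \<Longrightarrow> u \<noteq> v \<Longrightarrow> \<delta> \<le> torus_norm (u - v)"
    and n: "r \<le> n" "real n * \<delta> \<le> 1"
  obtains p where "degree p < n"
    "\<And>u. u \<in> B \<Longrightarrow> poly p (torus_char 1 u) = (if u = y then 1 else 0)"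
    "coeff_norm2 p \<le> 4 * (exp 1)\<^sup>2 / pi\<^sup>2 *
      ((floor_ratio (real n / real r) / (real r * real n))
        * (2 * exp 1 * floor_ratio (real n / real r) / sin (pi / 2 * real n * \<delta>)) ^ (2 * r - 2))"
proof -
  define q where "q = n div r"
  have r: "1 \<le> r" using B by (metis One_nat_def Suc_leI card_gt_0_iff empty_iff)
  have q: "1 \<le> q" using r n(1) by (simp add: q_def Suc_le_eq div_greater_zero_iff)
  have rq: "r * q \<le> n" by (simp add: q_def)
  define \<phi> where "\<phi> = floor_ratio (real n / real r)"
  have \<phi>: "\<phi> = real n / (real r * real q)" by (simp add: \<phi>_def q_def floor_ratio_divide)
  have "real (r * q) \<le> real n" using rq by (simp only: of_nat_le_iff)
  then have \<phi>1: "1 \<le> \<phi>" using r q by (simp add: \<phi>)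
  define S where "S = sin (pi / 2 * real n * \<delta>)"
  have n0: "0 < real n" using r n(1) by simp
  have arg: "0 < pi / 2 * real n * \<delta>" "pi / 2 * real n * \<delta> \<le> pi / 2"
    using n0 n(2) \<delta> mult_left_mono[OF n(2), of "pi / 2"] by (auto simp: mult_ac)
  have S: "0 < S" "S \<le> 1" "S \<le> pi / 2 * real n * \<delta>"
    unfolding S_def using arg sin_x_le_x[of "pi / 2 * real n * \<delta>"] by (auto intro!: sin_gt_zero)
  \<comment> \<open>\<open>K\<close> makes \<open>1 / \<sigma> u \<le> K / j\<close> true for both
    terms of the minimum. First, \<open>K * (2 / pi) = r * (\<phi> / S)\<close> is at least
    \<open>j\<close>. Second, \<open>K * q = pi * n / (2 * S)\<close>, so
    \<open>j * \<delta> \<le> 2 * d u\<close> and the bound of \<open>S\<close> by its argument give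
    \<open>j \<le> K * (2 * q * d u)\<close>.\<close>
  define K where "K = \<phi> / S * (pi * real r / 2)"
  have K: "0 \<le> K" using \<phi>1 S by (simp add: K_def)
  define d where "d u = torus_norm (u - y)" for u
  have d: "0 < d u" "d u \<le> 1 / 2" if "u \<in> B - {y}" for u
    using sep[of u y] that B(2) \<delta> torus_norm_le_half[of "u - y"] by (auto simp: d_def)
  have "\<exists>f. 1 \<le> f \<and> f \<le> q \<and> min (2 * real q * d u) (2 / pi) \<le> sin (pi * (real f * d u))"
    if u: "u \<in> B - {y}" for u
    using exists_frequency[OF d[OF u] q] by metis
  then have "\<exists>f. \<forall>u\<in>B - {y}. 1 \<le> f u \<and> f u \<le> q \<and> min (2 * real q * d u) (2 / pi) \<le> sin (pi * (real (f u) * d u))"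
    by (intro bchoice) blast
  then obtain f where f: "\<forall>u\<in>B - {y}. 1 \<le> f u \<and> f u \<le> q \<and> min (2 * real q * d u) (2 / pi) \<le> sin (pi * (real (f u) * d u))" ..
  define \<sigma> where "\<sigma> u = sin (pi * (real (f u) * d u))" for u
  have \<sigma>: "0 < \<sigma> u" "1 \<le> j \<Longrightarrow> j \<le> r \<Longrightarrow> real j * \<delta> \<le> 2 * torus_norm (u - y) \<Longrightarrow> 1 / \<sigma> u \<le> K / real j"
    if u: "u \<in> B - {y}" for u j
  proof -
    have m: "min (2 * real q * d u) (2 / pi) \<le> \<sigma> u" using f u by (auto simp: \<sigma>_def)
    have "0 < min (2 * real q * d u) (2 / pi)" using d[OF u] q by auto
    then show pos: "0 < \<sigma> u" using m by linarith
    assume j: "1 \<le> j" "j \<le> r" "real j * \<delta> \<le> 2 * torus_norm (u - y)"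
    have "real j * 1 \<le> real r * (\<phi> / S)"
      using j \<phi>1 S by (intro mult_mono) (auto simp: field_simps)
    then have "real j \<le> K * (2 / pi)" by (simp add: K_def field_simps)
    moreover have "real j \<le> K * (2 * real q * d u)"
    proof -
      have "real j * 1 \<le> real j * (pi / 2 * real n * \<delta> / S)"
        using S by (intro mult_left_mono) auto
      also have "\<dots> = K * (real q * (real j * \<delta>))"
        using r q S by (simp add: K_def \<phi> field_simps)
      also have "\<dots> \<le> K * (real q * (2 * d u))"
        using j K by (intro mult_left_mono) (auto simp: d_def)
      finally show ?thesis by (simp add: mult_ac)
    qed
    ultimately have "real j \<le> K * min (2 * real q * d u) (2 / pi)" by (simp add: min_def)
    also have "\<dots> \<le> K * \<sigma> u" using m K by (intro mult_left_mono) auto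
    finally show "1 / \<sigma> u \<le> K / real j" using pos j by (simp add: field_simps)
  qed
  have cardA: "card (B - {y}) = r - 1" using B by simp
  have prod: "(\<Prod>u\<in>B - {y}. 1 / \<sigma> u) \<le> K ^ (r - 1) / fact (r - 1)"
    unfolding cardA[symmetric]
    by (rule prod_le_power_div_fact[where r = r and \<delta> = \<delta> and y = y])
      (use B sep \<delta> K \<sigma> cardA in auto)
  define z where "z = torus_char 1 y"
  have "\<exists>p. degree p \<le> q \<and> poly p z = 1 \<and> poly p (torus_char 1 u) = 0
      \<and> (\<forall>w. cmod w = 1 \<longrightarrow> cmod (poly p w) \<le> 1 / \<sigma> u)" if u: "u \<in> B - {y}" for u
  proof -
    have nd: "cmod (z ^ f u - torus_char 1 u ^ f u) = 2 * \<sigma> u"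
      using \<sigma>(1)[OF u] cmod_torus_char_diff[of "f u" y u]
      by (simp add: z_def \<sigma>_def d_def torus_norm_minus_commute[of y]
          torus_char_conv_power[of "f u", symmetric] del: One_nat_def)
    then have ne: "z ^ f u \<noteq> torus_char 1 u ^ f u" using \<sigma>(1)[OF u] by auto
    show ?thesis
      by (rule sparse_linear_factor[of z "torus_char 1 u" "f u"])
        (use ne nd f u in \<open>force simp: z_def\<close>)+
  qed
  then have "\<exists>Q. \<forall>u\<in>B - {y}. degree (Q u) \<le> q \<and> poly (Q u) z = 1 \<and> poly (Q u) (torus_char 1 u) = 0
      \<and> (\<forall>w. cmod w = 1 \<longrightarrow> cmod (poly (Q u) w) \<le> 1 / \<sigma> u)"
    by (intro bchoice) blast
  then obtain Q where Q: "\<forall>u\<in>B - {y}. degree (Q u) \<le> q \<and> poly (Q u) z = 1 \<and> poly (Q u) (torus_char 1 u) = 0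
      \<and> (\<forall>w. cmod w = 1 \<longrightarrow> cmod (poly (Q u) w) \<le> 1 / \<sigma> u)" ..
  obtain D where D: "degree D < q" "poly D z = 1" "coeff_norm2 D = 1 / real q"
    using dirichlet_kernel[of q z] q by (auto simp: z_def)
  define R where "R = (\<Prod>u\<in>B - {y}. Q u)"
  have Rd: "degree R \<le> (r - 1) * q"
  proof -
    have "degree R \<le> (\<Sum>u\<in>B - {y}. degree (Q u))"
      using degree_prod_sum_le[of "B - {y}" Q] B(1) by (simp add: R_def o_def)
    also have "\<dots> \<le> (\<Sum>u\<in>B - {y}. q)" using Q by (intro sum_mono) auto
    finally show ?thesis by (simp add: cardA)
  qed
  have "(cmod (poly R w))\<^sup>2 \<le> (K ^ (r - 1) / fact (r - 1))\<^sup>2" if w: "cmod w = 1" for w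
  proof (rule power_mono)
    have "cmod (poly R w) = (\<Prod>u\<in>B - {y}. cmod (poly (Q u) w))"
      by (simp add: R_def poly_prod flip: prod_norm)
    also have "\<dots> \<le> (\<Prod>u\<in>B - {y}. 1 / \<sigma> u)" using Q w by (intro prod_mono) auto
    finally show "cmod (poly R w) \<le> K ^ (r - 1) / fact (r - 1)" using prod by linarith
  qed simp
  then have norm: "coeff_norm2 (D * R) \<le> (K ^ (r - 1) / fact (r - 1))\<^sup>2 * coeff_norm2 D"
    by (rule coeff_norm2_mult_le)
  define E where "E = 2 * exp 1 * \<phi> / S"
  \<comment> \<open>Here \<open>pi_power_le_fact\<close> replaces the factorial:
    \<open>r - 1\<close> of the \<open>r\<close> factors \<open>2 * exp 1\<close> enter
    \<open>E\<close>, and the last one forms the prefactor.\<close>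
  have "K ^ (r - 1) / fact (r - 1) \<le> 2 * exp 1 / (pi * real r) * E ^ (r - 1)"
  proof -
    have "(pi * real r / 2) ^ (r - 1) / fact (r - 1) \<le> (2 * exp 1) ^ r / (real r * pi)"
      using pi_power_le_fact[OF r] r by (simp add: field_simps)
    moreover have "(2 * exp 1 :: real) ^ r = (2 * exp 1) ^ (r - 1) * (2 * exp 1)"
      using r by (cases r) auto
    ultimately have "(\<phi> / S) ^ (r - 1) * ((pi * real r / 2) ^ (r - 1) / fact (r - 1))
        \<le> (\<phi> / S) ^ (r - 1) * ((2 * exp 1) ^ (r - 1) * (2 * exp 1) / (real r * pi))"
      using \<phi>1 S by (intro mult_left_mono) auto
    moreover have "K ^ (r - 1) / fact (r - 1) = (\<phi> / S) ^ (r - 1) * ((pi * real r / 2) ^ (r - 1) / fact (r - 1))"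
    proof -
      have "K ^ (r - 1) = (\<phi> / S) ^ (r - 1) * (pi * real r / 2) ^ (r - 1)"
        unfolding K_def by (rule power_mult_distrib)
      then show ?thesis by simp
    qed
    moreover have "E ^ (r - 1) = (\<phi> / S) ^ (r - 1) * (2 * exp 1) ^ (r - 1)"
    proof -
      have "E = \<phi> / S * (2 * exp 1)" by (simp add: E_def)
      then show ?thesis by (simp only: power_mult_distrib)
    qed
    ultimately show ?thesis by (simp add: mult_ac)
  qed
  then have "(K ^ (r - 1) / fact (r - 1))\<^sup>2 \<le> (2 * exp 1 / (pi * real r) * E ^ (r - 1))\<^sup>2"
    using K by (intro power_mono) auto
  then have "(K ^ (r - 1) / fact (r - 1))\<^sup>2 * coeff_norm2 D
      \<le> (2 * exp 1 / (pi * real r) * E ^ (r - 1))\<^sup>2 * (1 / real q)"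
    unfolding D(3) by (intro mult_right_mono) auto
  also have "\<dots> = 4 * (exp 1)\<^sup>2 / pi\<^sup>2 * (1 / (real r * real r * real q) * (E ^ (r - 1))\<^sup>2)"
    by (simp add: power_mult_distrib power_divide power2_eq_square[of "real r"])
  \<comment> \<open>The square of \<open>r\<close> comes from the prefactor and \<open>q\<close>
    from the Dirichlet kernel; \<open>\<phi>\<close> absorbs the rounding in
    \<open>q = n div r\<close>.\<close>
  also have "1 / (real r * real r * real q) = \<phi> / (real r * real n)"
    using n0 by (simp add: \<phi>)
  also have "(E ^ (r - 1))\<^sup>2 = E ^ (2 * r - 2)"
    by (simp add: diff_mult_distrib2 mult.commute flip: power_mult)
  finally have bound: "coeff_norm2 (D * R)
      \<le> 4 * (exp 1)\<^sup>2 / pi\<^sup>2 * (\<phi> / (real r * real n) * E ^ (2 * r - 2))"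
    using norm by linarith
  show ?thesis
  proof (rule that[of "D * R"])
    have "degree (D * R) \<le> degree D + degree R" by (rule degree_mult_le)
    also have "\<dots> < q + (r - 1) * q" using D(1) Rd by linarith
    also have "\<dots> = r * q" using r by (cases r) auto
    finally show "degree (D * R) < n" using rq by linarith
    show "poly (D * R) (torus_char 1 u) = (if u = y then 1 else 0)" if u: "u \<in> B" for u
    proof (cases "u = y")
      case True
      have "poly R z = 1" using Q by (simp add: R_def poly_prod)
      then show ?thesis using True D(2) by (simp add: z_def)
    next
      case False
      then have "poly (Q u) (torus_char 1 u) = 0" "u \<in> B - {y}" using Q u by auto
      then have "poly R (torus_char 1 u) = 0"
        unfolding R_def poly_prod using B(1) by (intro prod_zero) auto
      then show ?thesis using False by simp
    qed
  qed (use bound in \<open>simp add: E_def \<phi>_def S_def\<close>)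
qed

section \<open>The smallest singular value\<close>

text \<open>For an eigenvector \<open>v\<close> of the adjoint of \<open>A\<close> times
  \<open>A\<close>, the squared norm of \<open>A v\<close> is \<mu> times that of \<open>v\<close>.
  Since \<open>F\<close> recovers \<open>v\<close> from \<open>A v\<close>, Cauchy-Schwarz in each
  row bounds the squared norm of \<open>v\<close> by the squared Frobenius norm of \<open>F\<close>
  times that of \<open>A v\<close>.\<close>

lemma singular_value_bound_of_left_inverse:
  fixes A :: "complex mat" and F :: "nat \<Rightarrow> nat \<Rightarrow> complex"
  assumes A: "A \<in> carrier_mat m s" and i: "i < s"
    and F: "\<And>k l. k < s \<Longrightarrow> l < s \<Longrightarrow> (\<Sum>j<m. F k j * A $$ (j, l)) = (if k = l then 1 else 0)"
  shows "0 \<le> singular_values A ! i"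
    "1 \<le> (\<Sum>k<s. \<Sum>j<m. (cmod (F k j))\<^sup>2) * (singular_values A ! i)\<^sup>2"
proof -
  define M where "M = mat_adjoint A * A"
  define \<sigma> where "\<sigma> = singular_values A ! i"
  have adj: "mat_adjoint A \<in> carrier_mat s m" using A by (auto simp: mat_adjoint_def)
  have M: "M \<in> carrier_mat s s" using A adj by (simp add: M_def)
  have cp: "char_poly M \<noteq> 0" using degree_monic_char_poly[OF M] by auto
  have "\<sigma> \<in> set (singular_values A)"
    unfolding \<sigma>_def using i length_singular_values[OF A] by (intro nth_mem) simp
  then obtain \<mu> where \<mu>: "poly (char_poly M) \<mu> = 0" "\<sigma> = sqrt (Re \<mu>)"
    using cp by (auto simp: singular_values_def M_def)
  then have "eigenvalue M \<mu>" using eigenvalue_root_char_poly[OF M] by simp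
  then obtain v where v: "v \<in> carrier_vec s" "v \<noteq> 0\<^sub>v s" "M *\<^sub>v v = \<mu> \<cdot>\<^sub>v v"
    using M by (auto simp: eigenvalue_def eigenvector_def)
  define x where "x = vec_index v"
  define w where "w j = (\<Sum>l<s. A $$ (j, l) * x l)" for j
  have Av: "vec_index (A *\<^sub>v v) j = w j" if "j < m" for j
    using that A v(1) by (simp add: w_def x_def scalar_prod_def atLeast0LessThan)
  have Mv: "(\<Sum>j<m. cnj (A $$ (j, k)) * w j) = \<mu> * x k" if k: "k < s" for k
  proof -
    have "\<mu> * x k = vec_index (M *\<^sub>v v) k" using k v by (simp add: x_def)
    also have "M *\<^sub>v v = mat_adjoint A *\<^sub>v (A *\<^sub>v v)"
      unfolding M_def by (rule assoc_mult_mat_vec[OF adj A v(1)])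
    also have "vec_index \<dots> k = (\<Sum>j<m. mat_adjoint A $$ (k, j) * w j)"
      using k adj A v(1) Av by (simp add: scalar_prod_def atLeast0LessThan)
    also have "\<dots> = (\<Sum>j<m. cnj (A $$ (j, k)) * w j)"
      using k A by (intro sum.cong) (auto simp: mat_adjoint_def mat_of_rows_def)
    finally show ?thesis by simp
  qed
  define V where "V = (\<Sum>k<s. (cmod (x k))\<^sup>2)"
  define W where "W = (\<Sum>j<m. (cmod (w j))\<^sup>2)"
  define N where "N = (\<Sum>k<s. \<Sum>j<m. (cmod (F k j))\<^sup>2)"
  have "cnj (w j) = (\<Sum>k<s. cnj (A $$ (j, k) * x k))" for j by (simp add: w_def)
  then have "complex_of_real W = (\<Sum>j<m. \<Sum>k<s. w j * cnj (A $$ (j, k) * x k))"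
    by (simp only: W_def of_real_sum complex_norm_square sum_distrib_left)
  also have "\<dots> = (\<Sum>k<s. \<Sum>j<m. w j * cnj (A $$ (j, k) * x k))" by (rule sum.swap)
  also have "\<dots> = (\<Sum>k<s. cnj (x k) * (\<Sum>j<m. cnj (A $$ (j, k)) * w j))"
    by (simp add: sum_distrib_left mult_ac)
  also have "\<dots> = (\<Sum>k<s. \<mu> * (x k * cnj (x k)))"
    by (intro sum.cong refl) (simp add: Mv)
  also have "\<dots> = \<mu> * of_real V"
    by (simp only: V_def of_real_sum complex_norm_square sum_distrib_left)
  finally have "complex_of_real W = \<mu> * of_real V" .
  from arg_cong[OF this, of Re] have WV: "W = Re \<mu> * V" by simp
  have "\<exists>k<s. x k \<noteq> 0"
    using v(1,2) by (auto simp: x_def intro!: eq_vecI)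
  then obtain k0 where k0: "k0 < s" "x k0 \<noteq> 0" by blast
  then have "0 < (cmod (x k0))\<^sup>2" by simp
  also have "\<dots> \<le> V" unfolding V_def using k0 by (intro member_le_sum) auto
  finally have V: "0 < V" .
  have "V \<le> (\<Sum>k<s. (\<Sum>j<m. (cmod (F k j))\<^sup>2) * W)"
    unfolding V_def
  proof (rule sum_mono)
    fix k assume "k \<in> {..<s}"
    then have k: "k < s" by simp
    have "(\<Sum>j<m. F k j * w j) = (\<Sum>l<s. (\<Sum>j<m. F k j * A $$ (j, l)) * x l)"
      unfolding w_def sum_distrib_left sum_distrib_right
      by (subst sum.swap) (simp add: mult_ac)
    also have "\<dots> = (\<Sum>l<s. if l = k then x l else 0)"
      using F[OF k] by (intro sum.cong refl) auto
    also have "\<dots> = x k" using k by simp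
    finally have "x k = (\<Sum>j<m. F k j * w j)" ..
    then show "(cmod (x k))\<^sup>2 \<le> (\<Sum>j<m. (cmod (F k j))\<^sup>2) * W"
      unfolding W_def using norm_cauchy_schwarz_sum[of "F k" w "{..<m}"] by simp
  qed
  then have "1 * V \<le> N * Re \<mu> * V" by (simp add: N_def WV mult.assoc flip: sum_distrib_right)
  then have 1: "1 \<le> N * Re \<mu>" using V by (simp only: mult_le_cancel_right)
  \<comment> \<open>\<open>sqrt\<close> is odd on the reals, so the sign of \<open>Re \<mu>\<close>
    is settled before the singular value is declared nonnegative with square
    \<open>Re \<mu>\<close>.\<close>
  have "0 \<le> W" by (simp add: W_def sum_nonneg)
  then have "0 \<le> Re \<mu>" using WV V by (simp add: zero_le_mult_iff)
  then show "0 \<le> singular_values A ! i"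
    "1 \<le> (\<Sum>k<s. \<Sum>j<m. (cmod (F k j))\<^sup>2) * (singular_values A ! i)\<^sup>2"
    using 1 \<mu>(2) by (simp_all add: \<sigma>_def N_def)
qed

text \<open>Multiplying the coefficients of \<open>P k\<close> with a column of the Fourier matrix
  evaluates \<open>P k\<close> at the node of that column, so interpolation at the nodes is exactly
  a left inverse.\<close>

lemma fourier_singular_value_bound:
  assumes s: "1 \<le> s"
    and P: "\<And>k. k \<in> {1..s} \<Longrightarrow> degree (P k) < m"
    "\<And>k l. k \<in> {1..s} \<Longrightarrow> l \<in> {1..s} \<Longrightarrow> poly (P k) (torus_char 1 (x l)) = (if k = l then 1 else 0)"
    and c: "\<And>k. k \<in> {1..s} \<Longrightarrow> coeff_norm2 (P k) \<le> T k"
  shows "0 < singular_value s (fourier_matrix m s x)"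
    "1 / (singular_value s (fourier_matrix m s x))\<^sup>2 \<le> (\<Sum>k = 1..s. T k)"
proof -
  define A where "A = fourier_matrix m s x"
  define \<sigma> where "\<sigma> = singular_value s A"
  have A: "A \<in> carrier_mat m s" by (simp add: A_def fourier_matrix_def)
  have F: "(\<Sum>j<m. coeff (P (Suc k)) j * A $$ (j, l)) = (if k = l then 1 else 0)" if kl: "k < s" "l < s" for k l
  proof -
    have "(\<Sum>j<m. coeff (P (Suc k)) j * A $$ (j, l)) = (\<Sum>j<m. coeff (P (Suc k)) j * torus_char 1 (x (Suc l)) ^ j)"
      using kl by (intro sum.cong refl) (simp add: A_def fourier_matrix_def del: One_nat_def flip: torus_char_conv_power)
    also have "\<dots> = poly (P (Suc k)) (torus_char 1 (x (Suc l)))"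
      unfolding poly_altdef using P(1)[of "Suc k"] kl
      by (intro sum.mono_neutral_right) (auto simp: coeff_eq_0)
    finally show ?thesis using P(2)[of "Suc k" "Suc l"] kl by simp
  qed
  have "0 \<le> \<sigma>" "1 \<le> (\<Sum>k<s. \<Sum>j<m. (cmod (coeff (P (Suc k)) j))\<^sup>2) * \<sigma>\<^sup>2"
    using singular_value_bound_of_left_inverse[OF A _ F, of "s - 1"] s
    by (simp_all add: \<sigma>_def singular_value_def)
  moreover have "(\<Sum>k<s. \<Sum>j<m. (cmod (coeff (P (Suc k)) j))\<^sup>2) = (\<Sum>k<s. coeff_norm2 (P (Suc k)))"
    using P(1) by (intro sum.cong refl coeff_norm2_lessThan[symmetric]) auto
  moreover have "(\<Sum>k<s. coeff_norm2 (P (Suc k))) \<le> (\<Sum>k<s. T (Suc k))"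
    by (intro sum_mono c) auto
  moreover have "(\<Sum>k<s. T (Suc k)) = (\<Sum>k = 1..s. T k)" by (simp only: sum.atLeast1_atMost_eq One_nat_def)
  ultimately have 0: "0 \<le> \<sigma>" and 1: "1 \<le> (\<Sum>k = 1..s. T k) * \<sigma>\<^sup>2"
    by (auto intro: order.trans[OF _ mult_right_mono])
  \<comment> \<open>As 1 / 0 = 0, the reciprocal bound alone would not exclude a vanishing singular
    value; the product form does.\<close>
  have "\<sigma> \<noteq> 0" using 1 by auto
  then have "0 < \<sigma>" "1 / \<sigma>\<^sup>2 \<le> (\<Sum>k = 1..s. T k)" using 0 1 by (auto simp: field_simps)
  then show "0 < singular_value s (fourier_matrix m s x)"
    "1 / (singular_value s (fourier_matrix m s x))\<^sup>2 \<le> (\<Sum>k = 1..s. T k)"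
    by (simp_all add: \<sigma>_def A_def)
qed

section \<open>Combining near and far points\<close>

text \<open>The product \<open>b * g\<close> interpolates on all nodes. The degrees add up to less
  than \<open>m\<close> by the choice of \<open>n\<close>, and \<open>g\<close> costs only its
  squared maximum on the circle, a power of 2.\<close>

lemma node_interpolation:
  fixes n r m :: nat and \<delta> \<tau> :: real
  assumes X: "finite X" "y \<in> X" and \<tau>: "0 < \<tau>" "\<tau> < 1" and \<delta>: "0 < \<delta>"
    and sep: "\<And>u v. u \<in> X \<Longrightarrow> v \<in> X \<Longrightarrow> u \<noteq> v \<Longrightarrow> \<delta> \<le> torus_norm (u - v)"
    and r: "r = card (near_points y \<tau> X)" and n: "r \<le> n" "real n * \<delta> \<le> 1"
    and m: "real n + 2 * real (local_sparsity \<tau> (far_points y \<tau> X)) / \<tau> \<le> real m"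
  obtains p where "degree p < m"
    "\<And>u. u \<in> X \<Longrightarrow> poly p (torus_char 1 u) = (if u = y then 1 else 0)"
    "coeff_norm2 p \<le> 4 * (exp 1)\<^sup>2 / pi\<^sup>2 * (2 ^ local_sparsity \<tau> (far_points y \<tau> X)
      * (floor_ratio (real n / real r) / (real r * real n))
      * (2 * exp 1 * floor_ratio (real n / real r) / sin (pi / 2 * real n * \<delta>)) ^ (2 * r - 2))"
proof -
  define B where "B = near_points y \<tau> X"
  define G where "G = far_points y \<tau> X"
  have B: "finite B" "y \<in> B" "B \<subseteq> X" using X torus_norm_0 \<tau> by (auto simp: B_def near_points_def)
  have G: "finite G" using X by (simp add: G_def far_points_def)
  have XBG: "u \<in> B \<or> u \<in> G" if "u \<in> X" for u
    using that by (auto simp: B_def G_def near_points_def far_points_def)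
  have yG: "y \<notin> G" using torus_norm_0 \<tau> by (auto simp: G_def far_points_def)
  have far: "\<tau> < torus_norm (u - y)" if "u \<in> G" for u
    using that by (auto simp: G_def far_points_def torus_norm_minus_commute[of u])
  have sepB: "\<delta> \<le> torus_norm (u - v)" if "u \<in> B" "v \<in> B" "u \<noteq> v" for u v
    using sep[of u v] that B(3) by blast
  obtain b where b: "degree b < n"
    "\<And>u. u \<in> B \<Longrightarrow> poly b (torus_char 1 u) = (if u = y then 1 else 0)"
    "coeff_norm2 b \<le> 4 * (exp 1)\<^sup>2 / pi\<^sup>2 *
      ((floor_ratio (real n / real r) / (real r * real n))
        * (2 * exp 1 * floor_ratio (real n / real r) / sin (pi / 2 * real n * \<delta>)) ^ (2 * r - 2))"
    by (rule near_points_interpolation[OF B(1,2) r[folded B_def, symmetric] \<delta> sepB n]) (use that in blast)+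
  obtain g where g: "real (degree g) \<le> 2 * real (local_sparsity \<tau> G) / \<tau>"
    "poly g (torus_char 1 y) = 1" "\<And>u. u \<in> G \<Longrightarrow> poly g (torus_char 1 u) = 0"
    "\<And>w. cmod w = 1 \<Longrightarrow> (cmod (poly g w))\<^sup>2 \<le> 2 ^ local_sparsity \<tau> G"
    by (rule far_points_interpolation[OF G \<tau> far]) (use that in blast)+
  show ?thesis
  proof (rule that[of "b * g"])
    have "real (degree (b * g)) \<le> real (degree b) + real (degree g)"
      using degree_mult_le[of b g] by linarith
    then have "real (degree (b * g)) < real m" using b(1) g(1) m by (simp add: G_def)
    then show "degree (b * g) < m" by simp
    show "poly (b * g) (torus_char 1 u) = (if u = y then 1 else 0)" if "u \<in> X" for u
      using XBG[OF that] b(2)[of u] b(2)[OF B(2)] g(2) g(3)[of u] yG by auto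
    have "coeff_norm2 (b * g) \<le> 2 ^ local_sparsity \<tau> G * coeff_norm2 b"
      by (rule coeff_norm2_mult_le) (rule g(4))
    also have "\<dots> \<le> 2 ^ local_sparsity \<tau> G * (4 * (exp 1)\<^sup>2 / pi\<^sup>2 *
      ((floor_ratio (real n / real r) / (real r * real n))
        * (2 * exp 1 * floor_ratio (real n / real r) / sin (pi / 2 * real n * \<delta>)) ^ (2 * r - 2)))"
      by (intro mult_left_mono b(3)) simp
    finally show "coeff_norm2 (b * g) \<le> 4 * (exp 1)\<^sup>2 / pi\<^sup>2 * (2 ^ local_sparsity \<tau> (far_points y \<tau> X)
      * (floor_ratio (real n / real r) / (real r * real n))
      * (2 * exp 1 * floor_ratio (real n / real r) / sin (pi / 2 * real n * \<delta>)) ^ (2 * r - 2))"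
      by (simp add: G_def mult_ac)
  qed
qed

section \<open>Separation of the nodes and size of the summands\<close>

lemma min_separation_le:
  assumes "finite X" "u \<in> X" "v \<in> X" "u \<noteq> v"
  shows "min_separation X \<le> torus_norm (u - v)"
  unfolding min_separation_def
proof (rule Min_le)
  have "{torus_norm (y - y') |y y'. y \<in> X \<and> y' \<in> X \<and> y \<noteq> y'} \<subseteq> (\<lambda>(y, y'). torus_norm (y - y')) ` (X \<times> X)"
    by auto
  then show "finite {torus_norm (y - y') |y y'. y \<in> X \<and> y' \<in> X \<and> y \<noteq> y'}"
    by (rule finite_subset) (use assms(1) in simp)
qed (use assms in blast)

text \<open>Jordan's inequality replaces the sine by \<open>n * \<delta>\<close>. Then
  \<open>n\<close> cancels against the numerator of \<open>floor_ratio\<close>, and only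
  \<open>r * (n div r)\<close>, at least \<open>m / 6\<close>, remains.\<close>

lemma term_bound:
  fixes n r m :: nat and \<delta> :: real
  assumes r: "1 \<le> r" "r \<le> n" and \<delta>: "0 < \<delta>" "real n * \<delta> \<le> 1"
    and m: "real m / 6 \<le> real r * real (n div r)" "0 < m"
  shows "floor_ratio (real n / real r) / (real r * real n)
        * (2 * exp 1 * floor_ratio (real n / real r) / sin (pi / 2 * real n * \<delta>)) ^ (2 * r - 2)
      \<le> 6 / (real m * real r) * (12 * exp 1 / (real m * \<delta>)) ^ (2 * r - 2)"
proof -
  define q where "q = n div r"
  define \<phi> where "\<phi> = floor_ratio (real n / real r)"
  have n: "0 < real n" using r by simp
  have q: "0 < real r * real q" using m unfolding q_def[symmetric] by (smt (verit) of_nat_0_less_iff divide_pos_pos)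
  have \<phi>: "\<phi> = real n / (real r * real q)" by (simp add: \<phi>_def q_def floor_ratio_divide)
  have \<phi>0: "0 < \<phi>" using n q by (simp add: \<phi>)
  have q6: "1 / (real r * real q) \<le> 6 / real m"
    using m q unfolding q_def[symmetric] by (simp add: field_simps)
  have "\<phi> / (real r * real n) = 1 / (real r * real q) / real r" using n by (simp add: \<phi>)
  also have "\<dots> \<le> 6 / real m / real r" using q6 by (intro divide_right_mono) auto
  finally have 1: "\<phi> / (real r * real n) \<le> 6 / (real m * real r)" by simp
  have "2 * (real n * \<delta> / 2) \<le> sin (pi * (real n * \<delta> / 2))"
    using \<delta> n by (intro two_x_le_sin_pi) auto
  then have S: "real n * \<delta> \<le> sin (pi / 2 * real n * \<delta>)" by (simp add: mult_ac)
  have nd: "0 < real n * \<delta>" using n \<delta> by simp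
  have "2 * exp 1 * \<phi> / sin (pi / 2 * real n * \<delta>) \<le> 2 * exp 1 * \<phi> / (real n * \<delta>)"
    using S nd \<phi>0 by (intro divide_left_mono) auto
  also have "\<dots> = 2 * exp 1 / \<delta> * (1 / (real r * real q))" using n by (simp add: \<phi>)
  also have "\<dots> \<le> 2 * exp 1 / \<delta> * (6 / real m)" using q6 \<delta> by (intro mult_left_mono) auto
  finally have 2: "2 * exp 1 * \<phi> / sin (pi / 2 * real n * \<delta>) \<le> 12 * exp 1 / (real m * \<delta>)"
    by (simp add: mult_ac)
  have "0 \<le> 2 * exp 1 * \<phi> / sin (pi / 2 * real n * \<delta>)" using S nd \<phi>0 by simp
  then show ?thesis
    unfolding \<phi>_def[symmetric] using 1 2 \<phi>0 n by (intro mult_mono power_mono) auto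
qed

theorem theorem2:
  fixes m s :: nat and \<delta> \<tau> :: real
    and X :: "torus set" and x :: "nat \<Rightarrow> torus"
    and G :: "nat \<Rightarrow> torus set" and r :: "nat \<Rightarrow> nat" and n :: "nat \<Rightarrow> int"
  assumes "s \<ge> 2" and "m \<ge> 6 * s"
    and "0 < \<delta>" and "\<delta> \<le> 1 / real m"
    and "bij_betw x {1..s} X"
    and "min_separation X \<ge> \<delta>"
    and "0 < \<tau>" and "\<tau> \<le> 1 / 2"
    and "density_criterion m \<tau> X"
    and "\<And>k. k \<in> {1..s} \<Longrightarrow> G k = far_points (x k) \<tau> X"
    and "\<And>k. k \<in> {1..s} \<Longrightarrow> r k = card (near_points (x k) \<tau> X)"
    and "\<And>k. k \<in> {1..s} \<Longrightarrow> n k = \<lfloor>real m - 2 * real (local_sparsity \<tau> (G k)) / \<tau>\<rfloor>"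
  shows "singular_value s (fourier_matrix m s x) > 0
    \<and> 1 / (singular_value s (fourier_matrix m s x))\<^sup>2
      \<le> 4 * (exp 1)\<^sup>2 / pi\<^sup>2 *
        (\<Sum>k = 1..s. 2 ^ local_sparsity \<tau> (G k)
          * (floor_ratio (of_int (n k) / real (r k)) / (real (r k) * of_int (n k)))
          * (2 * exp 1 * floor_ratio (of_int (n k) / real (r k))
              / sin (pi / 2 * of_int (n k) * \<delta>)) ^ (2 * r k - 2))
    \<and> singular_value s (fourier_matrix m s x)
      \<ge> pi / (2 * exp 1) * sqrt (real m / (6 * real s)) *
        (MIN k\<in>{1..s}. sqrt (real (r k) / 2 ^ local_sparsity \<tau> (G k))
          * (real m * \<delta> / (12 * exp 1)) ^ (r k - 1))"
proof -
  note s = assms(1) and m = assms(2) and \<delta> = assms(3,4) and bij = assms(5) and sep = assms(6)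
    and \<tau> = assms(7,8) and dens = assms(9) and G = assms(10) and r = assms(11) and n = assms(12)
  define \<sigma> where "\<sigma> = singular_value s (fourier_matrix m s x)"
  define N where "N k = nat (n k)" for k
  define \<nu> where "\<nu> k = local_sparsity \<tau> (G k)" for k
  define E where "E k = floor_ratio (of_int (n k) / real (r k)) / (real (r k) * of_int (n k))
          * (2 * exp 1 * floor_ratio (of_int (n k) / real (r k))
              / sin (pi / 2 * of_int (n k) * \<delta>)) ^ (2 * r k - 2)" for k
  have m0: "0 < real m" using s m by simp
  have X: "finite X" using bij bij_betw_finite by blast
  have xX: "x k \<in> X" if "k \<in> {1..s}" for k using bij_betwE[OF bij] that by blast
  have cardX: "card X = s" using bij_betw_same_card[OF bij] by simp
  have inj: "x k = x l \<longleftrightarrow> k = l" if "k \<in> {1..s}" "l \<in> {1..s}" for k l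
    by (rule inj_on_eq_iff[OF bij_betw_imp_inj_on[OF bij] that])
  have sep': "\<delta> \<le> torus_norm (u - v)" if "u \<in> X" "v \<in> X" "u \<noteq> v" for u v
    using min_separation_le[OF X that] sep by linarith
  have facts: "1 \<le> r k" "r k \<le> N k" "real (N k) * \<delta> \<le> 1" "n k = int (N k)"
    "real (N k) + 2 * real (\<nu> k) / \<tau> \<le> real m"
    "real m / 6 \<le> real (r k) * real (N k div r k)" if k: "k \<in> {1..s}" for k
  proof -
    have near: "near_points (x k) \<tau> X \<subseteq> X" by (auto simp: near_points_def)
    have "x k \<in> near_points (x k) \<tau> X" using xX[OF k] torus_norm_0 \<tau> by (simp add: near_points_def)
    then have "card (near_points (x k) \<tau> X) \<noteq> 0"
      using finite_subset[OF near X] by auto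
    then show r1: "1 \<le> r k" by (simp add: r[OF k])
    have rs: "r k \<le> s" using card_mono[OF X near] by (simp add: r[OF k] cardX)
    have "\<nu> k \<le> local_sparsity \<tau> X"
      unfolding \<nu>_def G[OF k] by (rule local_sparsity_mono[OF _ X]) (auto simp: far_points_def)
    then have "real (\<nu> k) / \<tau> \<le> real (local_sparsity \<tau> X) / \<tau>"
      using \<tau> by (intro divide_right_mono) auto
    then have "3 * (real (\<nu> k) / \<tau>) \<le> real m" using dens by (simp add: density_criterion_def)
    moreover have "of_int (n k) \<le> real m - 2 * real (\<nu> k) / \<tau>"
      "real m - 2 * real (\<nu> k) / \<tau> < of_int (n k) + 1"
      unfolding n[OF k] \<nu>_def by linarith+
    moreover have "6 * real s \<le> real m" using m by linarith
    ultimately have b: "real m / 3 - 1 < of_int (n k)" "of_int (n k) + 2 * real (\<nu> k) / \<tau> \<le> real m"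
      and b': "6 * real s \<le> real m" by simp_all
    \<comment> \<open>The density criterion leaves \<open>n k > m / 3 - 1 \<ge> 2 * s - 1\<close>,
      and integrality improves this to \<open>2 * s\<close>. Hence \<open>n k\<close> is at least
      \<open>r k\<close>, and passing to a natural number loses nothing.\<close>
    have "real_of_int (2 * int s - 1) < of_int (n k)" using b(1) b' by simp
    then have ns: "2 * int s \<le> n k" by (simp only: of_int_less_iff)
    then show nN: "n k = int (N k)" by (simp add: N_def)
    then have N: "of_int (n k) = real (N k)" by simp
    show rN: "r k \<le> N k" using ns nN rs by linarith
    show Nm: "real (N k) + 2 * real (\<nu> k) / \<tau> \<le> real m" using b(2) N by simp
    have "0 \<le> 2 * real (\<nu> k) / \<tau>" using \<tau> by simp
    then have "real (N k) * \<delta> \<le> real m * (1 / real m)"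
      using Nm \<delta> by (intro mult_mono) auto
    then show "real (N k) * \<delta> \<le> 1" using m0 by simp
    \<comment> \<open>Rounding down to a multiple of \<open>r k\<close> loses at most
      \<open>s - 1\<close>, so more than \<open>m / 3 - s \<ge> m / 6\<close> remains. This is the
      origin of the constants 6 and 12 in the explicit bound.\<close>
    have "N k < r k * (N k div r k) + r k"
      using r1 mult_div_mod_eq[of "r k" "N k"] mod_less_divisor[of "r k" "N k"] by linarith
    then have "real (N k) + 1 \<le> real (r k) * real (N k div r k) + real (r k)"
      by (simp flip: of_nat_mult of_nat_add)
    then show "real m / 6 \<le> real (r k) * real (N k div r k)"
      using b(1) b' N rs by (simp add: field_simps)
  qed
  have "\<exists>p. degree p < m \<and> (\<forall>u\<in>X. poly p (torus_char 1 u) = (if u = x k then 1 else 0))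
    \<and> coeff_norm2 p \<le> 4 * (exp 1)\<^sup>2 / pi\<^sup>2 * (2 ^ \<nu> k * E k)" if k: "k \<in> {1..s}" for k
  proof (rule node_interpolation[OF X xX[OF k] \<tau>(1) _ \<delta>(1) sep' r[OF k] facts(2,3)[OF k]])
    show "real (N k) + 2 * real (local_sparsity \<tau> (far_points (x k) \<tau> X)) / \<tau> \<le> real m"
      using facts(5)[OF k] by (simp add: \<nu>_def G[OF k])
  qed (use \<tau> facts(4)[OF k] in \<open>auto simp: \<nu>_def E_def G[OF k] mult.assoc\<close>)
  then have "\<exists>P. \<forall>k\<in>{1..s}. degree (P k) < m
      \<and> (\<forall>u\<in>X. poly (P k) (torus_char 1 u) = (if u = x k then 1 else 0))
      \<and> coeff_norm2 (P k) \<le> 4 * (exp 1)\<^sup>2 / pi\<^sup>2 * (2 ^ \<nu> k * E k)"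
    by (intro bchoice) blast
  then obtain P where P: "\<forall>k\<in>{1..s}. degree (P k) < m
      \<and> (\<forall>u\<in>X. poly (P k) (torus_char 1 u) = (if u = x k then 1 else 0))
      \<and> coeff_norm2 (P k) \<le> 4 * (exp 1)\<^sup>2 / pi\<^sup>2 * (2 ^ \<nu> k * E k)" ..
  have P2: "poly (P k) (torus_char 1 (x l)) = (if k = l then 1 else 0)"
    if "k \<in> {1..s}" "l \<in> {1..s}" for k l
    using P xX[OF that(2)] inj[OF that] that by auto
  have \<sigma>: "0 < \<sigma>" "1 / \<sigma>\<^sup>2 \<le> (\<Sum>k = 1..s. 4 * (exp 1)\<^sup>2 / pi\<^sup>2 * (2 ^ \<nu> k * E k))"
  proof -
    have "1 \<le> s" using s by simp
    moreover have "degree (P k) < m" if "k \<in> {1..s}" for k using P that by blast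
    moreover have "coeff_norm2 (P k) \<le> 4 * (exp 1)\<^sup>2 / pi\<^sup>2 * (2 ^ \<nu> k * E k)" if "k \<in> {1..s}" for k
      using P that by blast
    ultimately show "0 < \<sigma>" "1 / \<sigma>\<^sup>2 \<le> (\<Sum>k = 1..s. 4 * (exp 1)\<^sup>2 / pi\<^sup>2 * (2 ^ \<nu> k * E k))"
      using P2 fourier_singular_value_bound[of s P m x "\<lambda>k. 4 * (exp 1)\<^sup>2 / pi\<^sup>2 * (2 ^ \<nu> k * E k)"]
      unfolding \<sigma>_def by blast+
  qed
  \<comment> \<open>The inverse square of \<open>C k\<close> times \<open>6 / m\<close> is the
    estimate of \<open>term_bound\<close> multiplied by \<open>2 ^ \<nu> k\<close>, so the minimum
    \<open>Q\<close> controls every summand.\<close>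
  define C where "C k = sqrt (real (r k) / 2 ^ \<nu> k) * (real m * \<delta> / (12 * exp 1)) ^ (r k - 1)" for k
  define Q where "Q = (MIN k\<in>{1..s}. C k)"
  have C0: "0 < C k" if "k \<in> {1..s}" for k
    using facts(1)[OF that] m0 \<delta> by (simp add: C_def)
  have "Q \<in> C ` {1..s}" unfolding Q_def using s by (intro Min_in) auto
  then have Q0: "0 < Q" using C0 by auto
  have QC: "Q \<le> C k" if "k \<in> {1..s}" for k unfolding Q_def using that by (intro Min_le) auto
  have term_le: "2 ^ \<nu> k * E k \<le> 6 / real m * (1 / Q\<^sup>2)" if k: "k \<in> {1..s}" for k
  proof -
    have "(C k)\<^sup>2 = real (r k) / 2 ^ \<nu> k * (real m * \<delta> / (12 * exp 1)) ^ (2 * r k - 2)"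
      by (simp add: C_def power_mult_distrib diff_mult_distrib2 mult.commute[of _ 2] flip: power_mult)
    then have C2: "1 / (C k)\<^sup>2 = 2 ^ \<nu> k / real (r k) * (12 * exp 1 / (real m * \<delta>)) ^ (2 * r k - 2)"
      by (simp add: power_divide)
    have "E k \<le> 6 / (real m * real (r k)) * (12 * exp 1 / (real m * \<delta>)) ^ (2 * r k - 2)"
      using term_bound[OF facts(1,2)[OF k] \<delta>(1) facts(3,6)[OF k]] m0 facts(4)[OF k] by (simp add: E_def)
    then have "2 ^ \<nu> k * E k
        \<le> 2 ^ \<nu> k * (6 / (real m * real (r k)) * (12 * exp 1 / (real m * \<delta>)) ^ (2 * r k - 2))"
      by (intro mult_left_mono) auto
    also have "\<dots> = 6 / real m * (1 / (C k)\<^sup>2)" by (simp add: C2)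
    also have "\<dots> \<le> 6 / real m * (1 / Q\<^sup>2)"
      using QC[OF k] Q0 m0 by (intro mult_left_mono divide_left_mono power_mono) auto
    finally show ?thesis .
  qed
  \<comment> \<open>\<open>R\<close> is chosen so that \<open>s\<close> copies of the largest
    admissible summand add up to the inverse of its square.\<close>
  define R where "R = pi / (2 * exp 1) * sqrt (real m / (6 * real s)) * Q"
  have "1 / \<sigma>\<^sup>2 \<le> (\<Sum>k = 1..s. 4 * (exp 1)\<^sup>2 / pi\<^sup>2 * (6 / real m * (1 / Q\<^sup>2)))"
    by (rule order.trans[OF \<sigma>(2)]) (intro sum_mono mult_left_mono term_le, auto)
  also have "\<dots> = 1 / R\<^sup>2"
    unfolding R_def using m0 s by (simp add: power_mult_distrib power_divide mult_ac)
  finally have "1 / \<sigma>\<^sup>2 \<le> 1 / R\<^sup>2" .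
  moreover have "0 < R\<^sup>2" using Q0 m0 s by (simp add: R_def)
  moreover have "0 < \<sigma>\<^sup>2" using \<sigma>(1) by simp
  ultimately have "R\<^sup>2 \<le> \<sigma>\<^sup>2" by (simp add: field_simps)
  then have "R \<le> \<sigma>" by (rule power2_le_imp_le) (use \<sigma>(1) in simp)
  moreover have "1 / \<sigma>\<^sup>2 \<le> 4 * (exp 1)\<^sup>2 / pi\<^sup>2 * (\<Sum>k = 1..s. 2 ^ \<nu> k * E k)"
    using \<sigma>(2) by (simp only: sum_distrib_left)
  ultimately show ?thesis
    using \<sigma>(1) unfolding R_def \<sigma>_def Q_def C_def \<nu>_def E_def mult.assoc by blast
qed

end
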